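(* Let $M$ be an irreducible based module of rank $3$ over the complex representation ring $r(S_4)$ of the symmetric group $S_4$. Then $M$ is equivalent to one of the following based modules $M_{3,1},M_{3,2},M_{3,3}$, given by the matrices of $V_\psi,V_{\rho_1},V_{\rho_2}$ (with $V_{\rho_3}=V_\psi V_{\rho_2}$ acting by the product of the matrices of $V_\psi$ and $V_{\rho_2}$): $M_{3,1}$: $V_\psi\mapsto\begin{pmatrix}1&0&0\\0&1&0\\0&0&1\end{pmatrix}$, $V_{\rho_1}\mapsto\begin{pmatrix}0&1&1\\1&0&1\\1&1&0\end{pmatrix}$, $V_{\rho_2}\mapsto\begin{pmatrix}1&1&1\\1&1&1\\1&1&1\end{pmatrix}$; $M_{3,2}$: $V_\psi\mapsto\begin{pmatrix}0&1&0\\1&0&0\\0&0&1\end{pmatrix}$, $V_{\rho_1}\mapsto\begin{pmatrix}0&0&1\\0&0&1\\1&1&1\end{pmatrix}$, $V_{\rho_2}\mapsto\begin{pmatrix}1&0&1\\0&1&1\\1&1&2\end{pmatrix}$; $M_{3,3}$: $V_\psi\mapsto\begin{pmatrix}0&1&0\\1&0&0\\0&0&1\end{pmatrix}$, $V_{\rho_1}\mapsto\begin{pmatrix}0&0&1\\0&0&1\\1&1&1\end{pmatrix}$, $V_{\rho_2}\mapsto\begin{pmatrix}0&1&1\\1&0&1\\1&1&2\end{pmatrix}$.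
   Context: The ring $r(S_4)$ is the Grothendieck ring of finite-dimensional complex representations of $S_4$. It is commutative and free over $\mathbb{Z}$ with basis $\{1,V_\psi,V_{\rho_1},V_{\rho_2},V_{\rho_3}\}$, the classes of the irreducible representations: trivial, sign, the 2-dimensional one, the 3-dimensional standard one, and $V_{\rho_3}=V_\psi V_{\rho_2}$. The products are determined by $V_\psi^2=1$, $V_\psi V_{\rho_1}=V_{\rho_1}$, $V_\psi V_{\rho_2}=V_{\rho_3}$, $V_{\rho_1}^2=1+V_\psi+V_{\rho_1}$, $V_{\rho_1}V_{\rho_2}=V_{\rho_2}+V_{\rho_3}$, $V_{\rho_2}^2=1+V_{\rho_1}+V_{\rho_2}+V_{\rho_3}$. All basis elements are self-dual. A $\mathbb{Z}_+$-module over $r(S_4)$ is an $r(S_4)$-module $M$ (with $1$ acting as identity) together with a fixed $\mathbb{Z}$-basis in which each basis element of $r(S_4)$ acts by a matrix with non-negative integer entries. Its rank is the size of the basis. It is a based module if, moreover, the matrix of each basis element of $r(S_4)$ is symmetric (this is the general condition $a_{il}^k=a_{i^*k}^l$ on structure constants $b_i m_l=\sum_k a_{il}^k m_k$, since here $i^*=i$). It is irreducible if it is nonzero and no nonempty proper subset of the fixed basis spans an $r(S_4)$-submodule. Two $\mathbb{Z}_+$-modules are equivalent if some bijection between their fixed bases induces an isomorphism of $r(S_4)$-modules, i.e. the representing matrices are simultaneously conjugate by a permutation matrix. *)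

theory Defs
  imports
    "HOL-Analysis.Analysis"
    "HOL-Algebra.Sym_Groups"
    "Jordan_Normal_Form.Matrix"
begin

section \<open>Block sums and Kronecker products of matrices\<close>

definition block_sum :: "'a::zero mat \<Rightarrow> 'a mat \<Rightarrow> 'a mat" where
  "block_sum A B =
     four_block_mat A (0\<^sub>m (dim_row A) (dim_col B)) (0\<^sub>m (dim_row B) (dim_col A)) B"

definition kronecker :: "'a::times mat \<Rightarrow> 'a mat \<Rightarrow> 'a mat" where
  "kronecker A B = mat (dim_row A * dim_row B) (dim_col A * dim_col B)
     (\<lambda>(i, j). A $$ (i div dim_row B, j div dim_col B) * B $$ (i mod dim_row B, j mod dim_col B))"

lemma block_sum_dim [simp]:
  "dim_row (block_sum A B) = dim_row A + dim_row B"
  "dim_col (block_sum A B) = dim_col A + dim_col B"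
  by (simp_all add: block_sum_def)

lemma block_sum_carrier [intro, simp]:
  "A \<in> carrier_mat a a' \<Longrightarrow> B \<in> carrier_mat b b' \<Longrightarrow> block_sum A B \<in> carrier_mat (a + b) (a' + b')"
  by auto

lemma block_sum_index:
  "i < dim_row A + dim_row B \<Longrightarrow> j < dim_col A + dim_col B \<Longrightarrow>
   block_sum A B $$ (i, j) =
     (if i < dim_row A then if j < dim_col A then A $$ (i, j) else 0
      else if j < dim_col A then 0 else B $$ (i - dim_row A, j - dim_col A))"
  by (auto simp: block_sum_def)

lemma block_sum_mult:
  fixes A B C D :: "'a::semiring_0 mat"
  assumes "A \<in> carrier_mat a a'" "C \<in> carrier_mat a' a''"
    and "B \<in> carrier_mat b b'" "D \<in> carrier_mat b' b''"
  shows "block_sum A B * block_sum C D = block_sum (A * C) (B * D)"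
proof -
  have "block_sum A B * block_sum C D =
    four_block_mat (A * C + 0\<^sub>m a b' * 0\<^sub>m b' a'') (A * 0\<^sub>m a' b'' + 0\<^sub>m a b' * D)
      (0\<^sub>m b a' * C + B * 0\<^sub>m b' a'') (0\<^sub>m b a' * 0\<^sub>m a' b'' + B * D)"
    using assms unfolding block_sum_def
    by (subst mult_four_block_mat[of _ a a' _ b' _ b _ _ a'' _ b'']) auto
  also have "\<dots> = block_sum (A * C) (B * D)"
    using assms by (auto simp: block_sum_def)
  finally show ?thesis .
qed

lemma block_sum_one: "block_sum (1\<^sub>m a) (1\<^sub>m b) = (1\<^sub>m (a + b) :: 'a::{zero,one} mat)"
  by (simp add: block_sum_def)

lemma block_sum_assoc: "block_sum (block_sum A B) C = block_sum A (block_sum B C)"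
  unfolding block_sum_def by (rule assoc_four_block_mat[symmetric])

lemma kronecker_dim [simp]:
  "dim_row (kronecker A B) = dim_row A * dim_row B"
  "dim_col (kronecker A B) = dim_col A * dim_col B"
  by (simp_all add: kronecker_def)

lemma kronecker_carrier [intro, simp]:
  "A \<in> carrier_mat a a' \<Longrightarrow> B \<in> carrier_mat b b' \<Longrightarrow> kronecker A B \<in> carrier_mat (a * b) (a' * b')"
  by auto

lemma kronecker_index:
  "i < dim_row A * dim_row B \<Longrightarrow> j < dim_col A * dim_col B \<Longrightarrow>
   kronecker A B $$ (i, j) =
     A $$ (i div dim_row B, j div dim_col B) * B $$ (i mod dim_row B, j mod dim_col B)"
  by (simp add: kronecker_def)

lemma div_mod_less_mult:
  fixes i :: nat
  assumes "i < a * b"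
  shows "i div b < a" "i mod b < b"
proof -
  have "b > 0" using assms by (cases b) auto
  then show "i div b < a" "i mod b < b"
    using assms by (auto simp: less_mult_imp_div_less)
qed

lemma sum_div_mod:
  fixes f :: "nat \<Rightarrow> nat \<Rightarrow> 'a::comm_monoid_add"
  shows "(\<Sum>k<a * b. f (k div b) (k mod b)) = (\<Sum>i<a. \<Sum>j<b. f i j)"
proof -
  have "(\<Sum>i<a. \<Sum>j<b. f i j) = (\<Sum>(i, j)\<in>{..<a} \<times> {..<b}. f i j)"
    by (simp add: sum.cartesian_product)
  also have "\<dots> = (\<Sum>k<a * b. f (k div b) (k mod b))"
  proof (rule sum.reindex_bij_witness[where i = "\<lambda>k. (k div b, k mod b)" and j = "\<lambda>(i, j). i * b + j"])
    fix x assume "x \<in> {..<a} \<times> {..<b}"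
    then obtain i j where x: "x = (i, j)" "i < a" "j < b" by auto
    have "i * b + j < (i + 1) * b" using x by simp
    also have "\<dots> \<le> a * b" using x by (intro mult_right_mono) auto
    finally show "(case x of (i, j) \<Rightarrow> i * b + j) \<in> {..<a * b}" using x by simp
  qed (auto simp: div_mod_less_mult)
  finally show ?thesis by simp
qed

lemma kronecker_mult:
  fixes A B C D :: "'a::comm_semiring_0 mat"
  assumes "A \<in> carrier_mat a a'" "C \<in> carrier_mat a' a''"
    and "B \<in> carrier_mat b b'" "D \<in> carrier_mat b' b''"
  shows "kronecker A B * kronecker C D = kronecker (A * C) (B * D)"
proof (rule eq_matI)
  fix i j assume "i < dim_row (kronecker (A * C) (B * D))" "j < dim_col (kronecker (A * C) (B * D))"
  then have ij: "i < a * b" "j < a'' * b''" using assms by auto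
  note dm = div_mod_less_mult[OF ij(1)] div_mod_less_mult[OF ij(2)]
  have "(kronecker A B * kronecker C D) $$ (i, j) =
      (\<Sum>k<a' * b'. kronecker A B $$ (i, k) * kronecker C D $$ (k, j))"
    using assms ij by (simp add: scalar_prod_def atLeast0LessThan)
  also have "\<dots> = (\<Sum>k<a' * b'. (A $$ (i div b, k div b') * B $$ (i mod b, k mod b')) *
      (C $$ (k div b', j div b'') * D $$ (k mod b', j mod b'')))"
    using assms ij by (intro sum.cong) (auto simp: kronecker_index)
  also have "\<dots> = (\<Sum>k<a'. \<Sum>l<b'. (A $$ (i div b, k) * B $$ (i mod b, l)) *
      (C $$ (k, j div b'') * D $$ (l, j mod b'')))"
    by (rule sum_div_mod)
  also have "\<dots> = (\<Sum>k<a'. A $$ (i div b, k) * C $$ (k, j div b'')) *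
      (\<Sum>l<b'. B $$ (i mod b, l) * D $$ (l, j mod b''))"
    by (simp add: sum_product mult_ac)
  also have "\<dots> = (A * C) $$ (i div b, j div b'') * (B * D) $$ (i mod b, j mod b'')"
    using assms dm by (simp add: scalar_prod_def atLeast0LessThan)
  also have "\<dots> = kronecker (A * C) (B * D) $$ (i, j)"
    using assms ij by (simp add: kronecker_index)
  finally show "(kronecker A B * kronecker C D) $$ (i, j) = kronecker (A * C) (B * D) $$ (i, j)" .
qed (use assms in auto)

lemma kronecker_one: "kronecker (1\<^sub>m a) (1\<^sub>m b) = (1\<^sub>m (a * b) :: 'a::semiring_1 mat)"
proof (rule eq_matI)
  fix i j assume "i < dim_row (1\<^sub>m (a * b) :: 'a mat)" "j < dim_col (1\<^sub>m (a * b) :: 'a mat)"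
  then have ij: "i < a * b" "j < a * b" by auto
  note dm = div_mod_less_mult[OF ij(1)] div_mod_less_mult[OF ij(2)]
  have "i = j \<longleftrightarrow> i div b = j div b \<and> i mod b = j mod b"
    by (metis div_mult_mod_eq)
  then show "kronecker (1\<^sub>m a) (1\<^sub>m b) $$ (i, j) = (1\<^sub>m (a * b) :: 'a mat) $$ (i, j)"
    using ij dm by (auto simp: kronecker_index)
qed auto

lemma kronecker_assoc:
  fixes A B C :: "'a::semigroup_mult mat"
  shows "kronecker (kronecker A B) C = kronecker A (kronecker B C)"
proof (rule eq_matI)
  fix i j assume "i < dim_row (kronecker A (kronecker B C))" "j < dim_col (kronecker A (kronecker B C))"
  then have i: "i < dim_row A * dim_row B * dim_row C" and j: "j < dim_col A * dim_col B * dim_col C"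
    by (auto simp: mult.assoc)
  have i': "i < dim_row A * (dim_row B * dim_row C)" and j': "j < dim_col A * (dim_col B * dim_col C)"
    using i j by (auto simp: mult.assoc)
  note d = div_mod_less_mult[OF i] div_mod_less_mult[OF j]
  note d' = div_mod_less_mult[OF i'] div_mod_less_mult[OF j']
  have *: "x div (b * c) = x div c div b" "x mod (b * c) div c = x div c mod b"
    "x mod (b * c) mod c = x mod c" if "0 < b" "0 < c" for x b c :: nat
    using that by (simp_all add: mult.commute[of b c] div_mult2_eq mod_mult2_eq)
  have pos: "0 < dim_row B" "0 < dim_row C" "0 < dim_col B" "0 < dim_col C"
    using i j by (auto intro: Nat.gr0I)
  show "kronecker (kronecker A B) C $$ (i, j) = kronecker A (kronecker B C) $$ (i, j)"
    using i j i' j' d d'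
    by (simp add: kronecker_index *[OF pos(1,2)] *[OF pos(3,4)] mult.assoc)
qed (simp_all add: mult.assoc)

lemma kronecker_block_sum_left:
  fixes A B C :: "'a::mult_zero mat"
  shows "kronecker (block_sum A B) C = block_sum (kronecker A C) (kronecker B C)"
proof (rule eq_matI)
  fix i j
  assume "i < dim_row (block_sum (kronecker A C) (kronecker B C))"
    and "j < dim_col (block_sum (kronecker A C) (kronecker B C))"
  then have i: "i < (dim_row A + dim_row B) * dim_row C" and j: "j < (dim_col A + dim_col B) * dim_col C"
    by (auto simp: distrib_right)
  note d = div_mod_less_mult[OF i] div_mod_less_mult[OF j]
  have less: "x div c < a \<longleftrightarrow> x < a * c" if "0 < c" for x a c :: nat
    using that by (simp add: div_less_iff_less_mult)
  have sub: "(x - a * c) div c = x div c - a" "(x - a * c) mod c = x mod c" if "a * c \<le> x" for x a c :: nat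
    using that by (cases "c = 0"; auto simp: le_iff_add)+
  have pos: "0 < dim_row C" "0 < dim_col C"
    using i j by (auto intro: Nat.gr0I)
  have lt: "i - dim_row A * dim_row C < dim_row B * dim_row C" if "\<not> i < dim_row A * dim_row C"
    using i that by (auto simp: distrib_right)
  have lt': "j - dim_col A * dim_col C < dim_col B * dim_col C" if "\<not> j < dim_col A * dim_col C"
    using j that by (auto simp: distrib_right)
  show "kronecker (block_sum A B) C $$ (i, j) = block_sum (kronecker A C) (kronecker B C) $$ (i, j)"
    using i j d lt lt' sub[of "dim_row A" "dim_row C" i] sub[of "dim_col A" "dim_col C" j]
    by (auto simp: kronecker_index block_sum_index less[OF pos(1)] less[OF pos(2)] distrib_right[symmetric])
qed (simp_all add: distrib_right)

section \<open>Finite-dimensional complex representations of the symmetric group\<close>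

definition is_representation :: "nat \<Rightarrow> ((nat \<Rightarrow> nat) \<Rightarrow> complex mat) \<Rightarrow> bool" where
  "is_representation n \<rho> \<longleftrightarrow>
     (\<forall>g\<in>carrier (sym_group 4). \<rho> g \<in> carrier_mat n n) \<and>
     \<rho> \<one>\<^bsub>sym_group 4\<^esub> = 1\<^sub>m n \<and>
     (\<forall>g\<in>carrier (sym_group 4). \<forall>h\<in>carrier (sym_group 4). \<rho> (g \<otimes>\<^bsub>sym_group 4\<^esub> h) = \<rho> g * \<rho> h)"

lemma is_representationI:
  assumes "\<And>g. g permutes {1..4} \<Longrightarrow> \<rho> g \<in> carrier_mat n n"
    and "\<rho> id = 1\<^sub>m n"
    and "\<And>g h. g permutes {1..4} \<Longrightarrow> h permutes {1..4} \<Longrightarrow> \<rho> (g \<circ> h) = \<rho> g * \<rho> h"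
  shows "is_representation n \<rho>"
  using assms by (simp add: is_representation_def sym_group_def)

typedef s4_rep = "{(n, \<rho>). is_representation n \<rho>}"
  by (rule exI[of _ "(0, \<lambda>_. 1\<^sub>m 0)"]) (auto intro!: is_representationI)

lifting_forget mat.lifting
setup_lifting type_definition_s4_rep

lift_definition rep_dim :: "s4_rep \<Rightarrow> nat" is fst .

lift_definition matrix_of :: "s4_rep \<Rightarrow> (nat \<Rightarrow> nat) \<Rightarrow> complex mat" is snd .

lemma matrix_of_carrier:
  "g permutes {1..4} \<Longrightarrow> matrix_of V g \<in> carrier_mat (rep_dim V) (rep_dim V)"
  by transfer (auto simp: is_representation_def sym_group_def)

lemma matrix_of_id: "matrix_of V id = 1\<^sub>m (rep_dim V)"
  by transfer (auto simp: is_representation_def sym_group_def)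

lemma matrix_of_comp:
  "g permutes {1..4} \<Longrightarrow> h permutes {1..4} \<Longrightarrow> matrix_of V (g \<circ> h) = matrix_of V g * matrix_of V h"
  by transfer (auto simp: is_representation_def sym_group_def)

definition isomorphic_rep :: "s4_rep \<Rightarrow> s4_rep \<Rightarrow> bool" where
  "isomorphic_rep V W \<longleftrightarrow> rep_dim V = rep_dim W \<and>
     (\<exists>T\<in>carrier_mat (rep_dim V) (rep_dim V). \<exists>T'\<in>carrier_mat (rep_dim V) (rep_dim V).
        T * T' = 1\<^sub>m (rep_dim V) \<and> T' * T = 1\<^sub>m (rep_dim V) \<and>
        (\<forall>g\<in>carrier (sym_group 4). T * matrix_of V g = matrix_of W g * T))"

lemma isomorphic_repI:
  assumes "rep_dim V = n" "rep_dim W = n" "T \<in> carrier_mat n n" "T' \<in> carrier_mat n n"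
    and "T * T' = 1\<^sub>m n" "T' * T = 1\<^sub>m n"
    and "\<And>g. g permutes {1..4} \<Longrightarrow> T * matrix_of V g = matrix_of W g * T"
  shows "isomorphic_rep V W"
  unfolding isomorphic_rep_def
proof (rule conjI, use assms in simp, rule bexI[of _ T], rule bexI[of _ T'], intro conjI ballI)
  show "T * matrix_of V g = matrix_of W g * T" if "g \<in> carrier (sym_group 4)" for g
    using that assms(7) by (simp add: sym_group_carrier)
qed (use assms in auto)

lemma isomorphic_repE:
  assumes "isomorphic_rep V W"
  obtains T T' where "T \<in> carrier_mat (rep_dim W) (rep_dim W)" "T' \<in> carrier_mat (rep_dim W) (rep_dim W)"
    and "rep_dim V = rep_dim W" "T * T' = 1\<^sub>m (rep_dim W)" "T' * T = 1\<^sub>m (rep_dim W)"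
    and "\<And>g. g permutes {1..4} \<Longrightarrow> T * matrix_of V g = matrix_of W g * T"
proof -
  obtain T T' where "T \<in> carrier_mat (rep_dim V) (rep_dim V)" "T' \<in> carrier_mat (rep_dim V) (rep_dim V)"
    "T * T' = 1\<^sub>m (rep_dim V)" "T' * T = 1\<^sub>m (rep_dim V)"
    "\<forall>g\<in>carrier (sym_group 4). T * matrix_of V g = matrix_of W g * T" and "rep_dim V = rep_dim W"
    using assms unfolding isomorphic_rep_def by blast
  then show thesis by (intro that[of T T']) (simp_all add: sym_group_carrier)
qed

text \<open>Matrices that agree up to a renumbering of the basis give isomorphic representations.\<close>

lemma isomorphic_rep_reindex:
  assumes deg: "rep_dim V = n" "rep_dim W = n" and \<sigma>: "bij_betw \<sigma> {..<n} {..<n}"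
    and eq: "\<And>g i j. g permutes {1..4} \<Longrightarrow> i < n \<Longrightarrow> j < n \<Longrightarrow>
      matrix_of W g $$ (\<sigma> i, \<sigma> j) = matrix_of V g $$ (i, j)"
  shows "isomorphic_rep V W"
proof -
  define T :: "complex mat" where "T = mat n n (\<lambda>(i, j). if i = \<sigma> j then 1 else 0)"
  define T' :: "complex mat" where "T' = mat n n (\<lambda>(i, j). if \<sigma> i = j then 1 else 0)"
  have lt: "\<sigma> i < n" if "i < n" for i using \<sigma> that by (auto simp: bij_betw_def)
  have inj: "\<sigma> i = \<sigma> j \<longleftrightarrow> i = j" if "i < n" "j < n" for i j
    using \<sigma> that by (auto simp: bij_betw_def inj_on_def)
  have surj: "\<exists>i'<n. \<sigma> i' = i" if "i < n" for i
    using bij_betw_imp_surj_on[OF \<sigma>] that by (metis imageE lessThan_iff)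
  have carr: "T \<in> carrier_mat n n" "T' \<in> carrier_mat n n" by (simp_all add: T_def T'_def)
  have prod: "(T * A) $$ (\<sigma> i, j) = A $$ (i, j)" "(A * T) $$ (i, j) = A $$ (i, \<sigma> j)"
    if A: "A \<in> carrier_mat n n" and ij: "i < n" "j < n" for A :: "complex mat" and i j
  proof -
    have "(T * A) $$ (\<sigma> i, j) = (\<Sum>k<n. (if i = k then 1 else 0) * A $$ (k, j))"
      using A ij lt inj by (auto simp: T_def scalar_prod_def atLeast0LessThan intro!: sum.cong)
    also have "\<dots> = (\<Sum>k<n. if i = k then A $$ (k, j) else 0)"
      by (intro sum.cong) auto
    finally show "(T * A) $$ (\<sigma> i, j) = A $$ (i, j)" using ij by simp
    have "(A * T) $$ (i, j) = (\<Sum>k<n. A $$ (i, k) * (if k = \<sigma> j then 1 else 0))"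
      using A ij lt inj by (auto simp: T_def scalar_prod_def atLeast0LessThan intro!: sum.cong)
    also have "\<dots> = (\<Sum>k<n. if k = \<sigma> j then A $$ (i, k) else 0)"
      by (intro sum.cong) auto
    finally show "(A * T) $$ (i, j) = A $$ (i, \<sigma> j)" using ij lt by simp
  qed
  have eqI: "A = B" if "A \<in> carrier_mat n n" "B \<in> carrier_mat n n"
    "\<And>i j. i < n \<Longrightarrow> j < n \<Longrightarrow> A $$ (\<sigma> i, j) = B $$ (\<sigma> i, j)" for A B :: "complex mat"
  proof (rule eq_matI)
    fix i j assume "i < dim_row B" "j < dim_col B"
    then have ij: "i < n" "j < n" using that by auto
    obtain i' where "i' < n" "\<sigma> i' = i" using surj ij(1) by blast
    then show "A $$ (i, j) = B $$ (i, j)" using that(3)[of i' j] ij by auto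
  qed (use that in auto)
  have TT': "T * T' = 1\<^sub>m n"
  proof (rule eqI)
    fix i j assume ij: "i < n" "j < n"
    then show "(T * T') $$ (\<sigma> i, j) = 1\<^sub>m n $$ (\<sigma> i, j)"
      by (subst prod(1)[OF carr(2) ij]) (simp add: T'_def lt)
  qed (use carr in auto)
  have T'T: "T' * T = 1\<^sub>m n"
  proof (rule eq_matI)
    fix i j assume "i < dim_row (1\<^sub>m n :: complex mat)" "j < dim_col (1\<^sub>m n :: complex mat)"
    then have ij: "i < n" "j < n" by auto
    then show "(T' * T) $$ (i, j) = 1\<^sub>m n $$ (i, j)"
      by (subst prod(2)[OF carr(2) ij]) (simp add: T'_def lt inj)
  qed (use carr in auto)
  show ?thesis
  proof (rule isomorphic_repI[OF deg carr TT' T'T])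
    fix g :: "nat \<Rightarrow> nat" assume g: "g permutes {1..4}"
    have c: "matrix_of V g \<in> carrier_mat n n" "matrix_of W g \<in> carrier_mat n n"
      using matrix_of_carrier[OF g] deg by metis+
    show "T * matrix_of V g = matrix_of W g * T"
    proof (rule eqI)
      fix i j assume ij: "i < n" "j < n"
      show "(T * matrix_of V g) $$ (\<sigma> i, j) = (matrix_of W g * T) $$ (\<sigma> i, j)"
        unfolding prod(1)[OF c(1) ij] prod(2)[OF c(2) lt[OF ij(1)] ij(2)] eq[OF g ij] ..
    qed (use c carr in auto)
  qed
qed

lemma isomorphic_rep_eq:
  assumes "rep_dim V = rep_dim W" and "\<And>g. g permutes {1..4} \<Longrightarrow> matrix_of V g = matrix_of W g"
  shows "isomorphic_rep V W"
  by (rule isomorphic_rep_reindex[of _ "rep_dim W" _ id]) (use assms in auto)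

lemma isomorphic_rep_refl: "isomorphic_rep V V"
  by (rule isomorphic_rep_eq) auto

lemma isomorphic_rep_sym:
  assumes "isomorphic_rep V W" shows "isomorphic_rep W V"
proof -
  obtain T T' where T: "T \<in> carrier_mat (rep_dim W) (rep_dim W)" "T' \<in> carrier_mat (rep_dim W) (rep_dim W)"
    "rep_dim V = rep_dim W" "T * T' = 1\<^sub>m (rep_dim W)" "T' * T = 1\<^sub>m (rep_dim W)"
    "\<And>g. g permutes {1..4} \<Longrightarrow> T * matrix_of V g = matrix_of W g * T"
    using assms by (rule isomorphic_repE) blast
  show ?thesis
  proof (rule isomorphic_repI[OF refl T(3) T(2,1,5,4)])
    fix g :: "nat \<Rightarrow> nat" assume g: "g permutes {1..4}"
    note V = matrix_of_carrier[OF g, of V, unfolded T(3)] and W = matrix_of_carrier[OF g, of W]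
    have "T' * matrix_of W g = T' * (matrix_of W g * (T * T'))" using T W by simp
    also have "\<dots> = T' * (matrix_of W g * T * T')"
      using T(1,2) W by (simp only: assoc_mult_mat[OF W T(1,2)])
    also have "\<dots> = T' * (T * matrix_of V g * T')" using T(6)[OF g] by simp
    also have "\<dots> = (T' * T) * (matrix_of V g * T')"
      using T(1,2) V by (simp add: assoc_mult_mat[of _ "rep_dim W" "rep_dim W" _ "rep_dim W" _ "rep_dim W"])
    also have "\<dots> = matrix_of V g * T'" using T V by simp
    finally show "T' * matrix_of W g = matrix_of V g * T'" .
  qed
qed

lemma isomorphic_rep_trans:
  assumes "isomorphic_rep U V" "isomorphic_rep V W" shows "isomorphic_rep U W"
proof -
  obtain T T' where T: "T \<in> carrier_mat (rep_dim V) (rep_dim V)" "T' \<in> carrier_mat (rep_dim V) (rep_dim V)"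
    "rep_dim U = rep_dim V" "T * T' = 1\<^sub>m (rep_dim V)" "T' * T = 1\<^sub>m (rep_dim V)"
    "\<And>g. g permutes {1..4} \<Longrightarrow> T * matrix_of U g = matrix_of V g * T"
    using assms(1) by (rule isomorphic_repE) blast
  obtain S S' where S: "S \<in> carrier_mat (rep_dim W) (rep_dim W)" "S' \<in> carrier_mat (rep_dim W) (rep_dim W)"
    "rep_dim V = rep_dim W" "S * S' = 1\<^sub>m (rep_dim W)" "S' * S = 1\<^sub>m (rep_dim W)"
    "\<And>g. g permutes {1..4} \<Longrightarrow> S * matrix_of V g = matrix_of W g * S"
    using assms(2) by (rule isomorphic_repE) blast
  define n where "n = rep_dim W"
  note T = T[unfolded S(3), folded n_def] and S = S[folded n_def]
  note assoc = assoc_mult_mat[of _ n n _ n _ n]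
  have "(S * T) * (T' * S') = S * ((T * T') * S')" using T(1,2) S(1,2) by (simp add: assoc)
  then have 1: "(S * T) * (T' * S') = 1\<^sub>m n" using T S by simp
  have "(T' * S') * (S * T) = T' * ((S' * S) * T)" using T(1,2) S(1,2) by (simp add: assoc)
  then have 2: "(T' * S') * (S * T) = 1\<^sub>m n" using T S by simp
  show ?thesis
  proof (rule isomorphic_repI[OF T(3) n_def[symmetric] _ _ 1 2])
    fix g :: "nat \<Rightarrow> nat" assume g: "g permutes {1..4}"
    have c: "matrix_of U g \<in> carrier_mat n n" "matrix_of V g \<in> carrier_mat n n" "matrix_of W g \<in> carrier_mat n n"
      using matrix_of_carrier[OF g] T(3) S(3) n_def by metis+
    have "S * T * matrix_of U g = S * (T * matrix_of U g)" using T(1) S(1) c by (simp add: assoc)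
    also have "\<dots> = (S * matrix_of V g) * T" using T(1) S(1) c by (simp add: T(6)[OF g] assoc)
    also have "\<dots> = matrix_of W g * (S * T)" using T(1) S(1) c by (simp add: S(6)[OF g] assoc)
    finally show "S * T * matrix_of U g = matrix_of W g * (S * T)" .
  qed (use T S in auto)
qed

subsection \<open>Direct sums and tensor products\<close>

lift_definition trivial_rep :: "nat \<Rightarrow> s4_rep" is "\<lambda>n. (n, \<lambda>_. 1\<^sub>m n)"
  by (auto intro!: is_representationI)

lemma is_representation_block_sum:
  assumes "is_representation n \<rho>" "is_representation m \<tau>"
  shows "is_representation (n + m) (\<lambda>g. block_sum (\<rho> g) (\<tau> g))"
proof (rule is_representationI)
  fix g h :: "nat \<Rightarrow> nat" assume "g permutes {1..4}" "h permutes {1..4}"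
  then show "block_sum (\<rho> (g \<circ> h)) (\<tau> (g \<circ> h)) = block_sum (\<rho> g) (\<tau> g) * block_sum (\<rho> h) (\<tau> h)"
    using assms by (subst block_sum_mult[of _ n n _ n _ m m _ m]) (auto simp: is_representation_def sym_group_def)
qed (use assms in \<open>auto simp: is_representation_def sym_group_def block_sum_one\<close>)

lift_definition direct_sum :: "s4_rep \<Rightarrow> s4_rep \<Rightarrow> s4_rep" is
  "\<lambda>(n, \<rho>) (m, \<tau>). (n + m, \<lambda>g. block_sum (\<rho> g) (\<tau> g))"
  by (auto intro!: is_representation_block_sum)

lemma is_representation_kronecker:
  assumes "is_representation n \<rho>" "is_representation m \<tau>"
  shows "is_representation (n * m) (\<lambda>g. kronecker (\<rho> g) (\<tau> g))"
proof (rule is_representationI)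
  fix g h :: "nat \<Rightarrow> nat" assume "g permutes {1..4}" "h permutes {1..4}"
  then show "kronecker (\<rho> (g \<circ> h)) (\<tau> (g \<circ> h)) = kronecker (\<rho> g) (\<tau> g) * kronecker (\<rho> h) (\<tau> h)"
    using assms by (subst kronecker_mult[of _ n n _ n _ m m _ m]) (auto simp: is_representation_def sym_group_def)
qed (use assms in \<open>auto simp: is_representation_def sym_group_def kronecker_one\<close>)

lift_definition tensor :: "s4_rep \<Rightarrow> s4_rep \<Rightarrow> s4_rep" is
  "\<lambda>(n, \<rho>) (m, \<tau>). (n * m, \<lambda>g. kronecker (\<rho> g) (\<tau> g))"
  by (auto intro!: is_representation_kronecker)

lemma rep_dim_simps [simp]:
  "rep_dim (trivial_rep n) = n"
  "rep_dim (direct_sum V W) = rep_dim V + rep_dim W"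
  "rep_dim (tensor V W) = rep_dim V * rep_dim W"
  by (transfer; auto)+

lemma matrix_of_simps [simp]:
  "matrix_of (trivial_rep n) g = 1\<^sub>m n"
  "matrix_of (direct_sum V W) g = block_sum (matrix_of V g) (matrix_of W g)"
  "matrix_of (tensor V W) g = kronecker (matrix_of V g) (matrix_of W g)"
  by (transfer; auto)+

lemma matrix_of_dim:
  assumes "g permutes {1..4}"
  shows "dim_row (matrix_of V g) = rep_dim V" "dim_col (matrix_of V g) = rep_dim V"
  using matrix_of_carrier[OF assms, of V] by auto

lemma direct_sum_cong:
  assumes "isomorphic_rep V V'" "isomorphic_rep W W'"
  shows "isomorphic_rep (direct_sum V W) (direct_sum V' W')"
proof -
  obtain T T' where T: "T \<in> carrier_mat (rep_dim V') (rep_dim V')" "T' \<in> carrier_mat (rep_dim V') (rep_dim V')"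
    "rep_dim V = rep_dim V'" "T * T' = 1\<^sub>m (rep_dim V')" "T' * T = 1\<^sub>m (rep_dim V')"
    "\<And>g. g permutes {1..4} \<Longrightarrow> T * matrix_of V g = matrix_of V' g * T"
    using assms(1) by (rule isomorphic_repE) blast
  obtain S S' where S: "S \<in> carrier_mat (rep_dim W') (rep_dim W')" "S' \<in> carrier_mat (rep_dim W') (rep_dim W')"
    "rep_dim W = rep_dim W'" "S * S' = 1\<^sub>m (rep_dim W')" "S' * S = 1\<^sub>m (rep_dim W')"
    "\<And>g. g permutes {1..4} \<Longrightarrow> S * matrix_of W g = matrix_of W' g * S"
    using assms(2) by (rule isomorphic_repE) blast
  show ?thesis
  proof (rule isomorphic_repI[where T = "block_sum T S" and T' = "block_sum T' S'"])
    show "block_sum T S * block_sum T' S' = 1\<^sub>m (rep_dim V' + rep_dim W')"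
      using T S by (subst block_sum_mult[OF T(1,2) S(1,2)]) (simp add: block_sum_one)
    show "block_sum T' S' * block_sum T S = 1\<^sub>m (rep_dim V' + rep_dim W')"
      using T S by (subst block_sum_mult[OF T(2,1) S(2,1)]) (simp add: block_sum_one)
    fix g :: "nat \<Rightarrow> nat" assume g: "g permutes {1..4}"
    show "block_sum T S * matrix_of (direct_sum V W) g = matrix_of (direct_sum V' W') g * block_sum T S"
      using T(3) S(3) matrix_of_carrier[OF g, of V] matrix_of_carrier[OF g, of W]
      by (simp add: block_sum_mult[OF T(1) _ S(1)] T(6)[OF g] S(6)[OF g]
          block_sum_mult[OF matrix_of_carrier[OF g] T(1) matrix_of_carrier[OF g] S(1)])
  qed (use T S in auto)
qed

lemma tensor_cong:
  assumes "isomorphic_rep V V'" "isomorphic_rep W W'"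
  shows "isomorphic_rep (tensor V W) (tensor V' W')"
proof -
  obtain T T' where T: "T \<in> carrier_mat (rep_dim V') (rep_dim V')" "T' \<in> carrier_mat (rep_dim V') (rep_dim V')"
    "rep_dim V = rep_dim V'" "T * T' = 1\<^sub>m (rep_dim V')" "T' * T = 1\<^sub>m (rep_dim V')"
    "\<And>g. g permutes {1..4} \<Longrightarrow> T * matrix_of V g = matrix_of V' g * T"
    using assms(1) by (rule isomorphic_repE) blast
  obtain S S' where S: "S \<in> carrier_mat (rep_dim W') (rep_dim W')" "S' \<in> carrier_mat (rep_dim W') (rep_dim W')"
    "rep_dim W = rep_dim W'" "S * S' = 1\<^sub>m (rep_dim W')" "S' * S = 1\<^sub>m (rep_dim W')"
    "\<And>g. g permutes {1..4} \<Longrightarrow> S * matrix_of W g = matrix_of W' g * S"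
    using assms(2) by (rule isomorphic_repE) blast
  show ?thesis
  proof (rule isomorphic_repI[where T = "kronecker T S" and T' = "kronecker T' S'"])
    show "kronecker T S * kronecker T' S' = 1\<^sub>m (rep_dim V' * rep_dim W')"
      using T S by (subst kronecker_mult[OF T(1,2) S(1,2)]) (simp add: kronecker_one)
    show "kronecker T' S' * kronecker T S = 1\<^sub>m (rep_dim V' * rep_dim W')"
      using T S by (subst kronecker_mult[OF T(2,1) S(2,1)]) (simp add: kronecker_one)
    fix g :: "nat \<Rightarrow> nat" assume g: "g permutes {1..4}"
    show "kronecker T S * matrix_of (tensor V W) g = matrix_of (tensor V' W') g * kronecker T S"
      using T(3) S(3) matrix_of_carrier[OF g, of V] matrix_of_carrier[OF g, of W]
      by (simp add: kronecker_mult[OF T(1) _ S(1)] T(6)[OF g] S(6)[OF g]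
          kronecker_mult[OF matrix_of_carrier[OF g] T(1) matrix_of_carrier[OF g] S(1)])
  qed (use T S in auto)
qed

lemma direct_sum_assoc: "isomorphic_rep (direct_sum (direct_sum U V) W) (direct_sum U (direct_sum V W))"
  by (rule isomorphic_rep_eq) (auto simp: block_sum_assoc)

lemma direct_sum_zero: "isomorphic_rep (direct_sum (trivial_rep 0) V) V"
proof (rule isomorphic_rep_eq)
  fix g :: "nat \<Rightarrow> nat" assume "g permutes {1..4}"
  show "matrix_of (direct_sum (trivial_rep 0) V) g = matrix_of V g"
    by (rule eq_matI) (auto simp: block_sum_index)
qed auto

lemma direct_sum_comm: "isomorphic_rep (direct_sum V W) (direct_sum W V)"
proof -
  define \<sigma> where "\<sigma> i = (if i < rep_dim V then i + rep_dim W else i - rep_dim V)" for i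
  have "bij_betw \<sigma> {..<rep_dim V + rep_dim W} {..<rep_dim V + rep_dim W}"
    by (rule bij_betw_byWitness[where f' = "\<lambda>i. if i < rep_dim W then i + rep_dim V else i - rep_dim W"])
      (auto simp: \<sigma>_def)
  then show ?thesis
    by (rule isomorphic_rep_reindex[rotated 2])
      (auto simp: \<sigma>_def block_sum_index matrix_of_dim)
qed

lemma tensor_assoc: "isomorphic_rep (tensor (tensor U V) W) (tensor U (tensor V W))"
  by (rule isomorphic_rep_eq) (auto simp: kronecker_assoc)

lemma tensor_one: "isomorphic_rep (tensor (trivial_rep 1) V) V"
proof (rule isomorphic_rep_eq)
  fix g :: "nat \<Rightarrow> nat" assume g: "g permutes {1..4}"
  show "matrix_of (tensor (trivial_rep 1) V) g = matrix_of V g"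
    by (rule eq_matI) (auto simp: kronecker_index matrix_of_dim[OF g])
qed auto

lemma tensor_zero: "isomorphic_rep (tensor (trivial_rep 0) V) (trivial_rep 0)"
  by (rule isomorphic_rep_eq) (auto intro: eq_matI)

lemma tensor_direct_sum:
  "isomorphic_rep (tensor (direct_sum U V) W) (direct_sum (tensor U W) (tensor V W))"
  by (rule isomorphic_rep_eq) (auto simp: kronecker_block_sum_left distrib_right)

lemma tensor_comm: "isomorphic_rep (tensor V W) (tensor W V)"
proof -
  define n m where "n = rep_dim V" and "m = rep_dim W"
  define \<sigma> where "\<sigma> i = (i mod m) * n + i div m" for i
  have mem: "i mod a * b + i div a < b * a" if "i < b * a" for i a b :: nat
  proof -
    have "i mod a * b + i div a < (i mod a + 1) * b" using div_mod_less_mult[OF that] by simp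
    also have "\<dots> \<le> a * b" using div_mod_less_mult[OF that] by (intro mult_right_mono) auto
    finally show ?thesis by (simp add: mult.commute)
  qed
  have "bij_betw \<sigma> {..<n * m} {..<n * m}"
  proof (rule bij_betw_byWitness[where f' = "\<lambda>i. (i mod n) * m + i div n"])
    show "\<sigma> ` {..<n * m} \<subseteq> {..<n * m}" using mem by (auto simp: \<sigma>_def)
    show "(\<lambda>i. (i mod n) * m + i div n) ` {..<n * m} \<subseteq> {..<n * m}"
      using mem[of _ m n] by (auto simp: mult.commute)
    have inv: "(i mod a * b + i div a) mod b * a + (i mod a * b + i div a) div b = i"
      if "i < b * a" for i a b :: nat
    proof -
      have "i div a < b" using div_mod_less_mult[OF that] by simp
      then have "(i mod a * b + i div a) mod b = i div a" "(i mod a * b + i div a) div b = i mod a"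
        by simp_all
      then show ?thesis by simp
    qed
    show "\<forall>i\<in>{..<n * m}. \<sigma> i mod n * m + \<sigma> i div n = i"
      using inv by (simp add: \<sigma>_def)
    show "\<forall>i\<in>{..<n * m}. \<sigma> (i mod n * m + i div n) = i"
      using inv[of _ m n] by (simp add: \<sigma>_def mult.commute[of n m])
  qed
  then show ?thesis
  proof (rule isomorphic_rep_reindex[rotated 2])
    fix g :: "nat \<Rightarrow> nat" and i j assume g: "g permutes {1..4}" and ij: "i < n * m" "j < n * m"
    note d = div_mod_less_mult[OF ij(1)] div_mod_less_mult[OF ij(2)]
    have "\<sigma> i < m * n" "\<sigma> j < m * n" using mem[of i n m] mem[of j n m] ij by (simp_all add: \<sigma>_def mult.commute[of m n])
    then show "matrix_of (tensor W V) g $$ (\<sigma> i, \<sigma> j) = matrix_of (tensor V W) g $$ (i, j)"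
      using ij d by (simp add: kronecker_index matrix_of_dim[OF g] n_def[symmetric] m_def[symmetric])
        (simp add: \<sigma>_def)
  qed (auto simp: n_def m_def)
qed

section \<open>The representation ring\<close>

subsection \<open>The semiring of isomorphism classes\<close>

quotient_type rep_class = s4_rep / isomorphic_rep
  by (intro equivpI reflpI sympI transpI)
    (fact isomorphic_rep_refl, erule isomorphic_rep_sym, erule (1) isomorphic_rep_trans)

instantiation rep_class :: comm_semiring_1
begin

lift_definition zero_rep_class :: rep_class is "trivial_rep 0" .
lift_definition one_rep_class :: rep_class is "trivial_rep 1" .
lift_definition plus_rep_class :: "rep_class \<Rightarrow> rep_class \<Rightarrow> rep_class" is direct_sum
  by (rule direct_sum_cong)
lift_definition times_rep_class :: "rep_class \<Rightarrow> rep_class \<Rightarrow> rep_class" is tensor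
  by (rule tensor_cong)

instance
proof
  fix a b c :: rep_class
  show "a + b + c = a + (b + c)" by transfer (rule direct_sum_assoc)
  show "a + b = b + a" by transfer (rule direct_sum_comm)
  show "0 + a = a" by transfer (rule direct_sum_zero)
  show "a * b * c = a * (b * c)" by transfer (rule tensor_assoc)
  show "a * b = b * a" by transfer (rule tensor_comm)
  show "1 * a = a" by transfer (rule tensor_one)
  show "(a + b) * c = a * c + b * c" by transfer (rule tensor_direct_sum)
  show z: "0 * a = 0" by transfer (rule tensor_zero)
  have "a * 0 = 0 * a" by transfer (rule tensor_comm)
  then show "a * 0 = 0" using z by simp
  show "(0::rep_class) \<noteq> 1" by transfer (auto simp: isomorphic_rep_def)
qed

end

lift_definition class_degree :: "rep_class \<Rightarrow> nat" is rep_dim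
  by (simp add: isomorphic_rep_def)

lemma class_rep_dim_simps [simp]:
  "class_degree 0 = 0" "class_degree 1 = 1" "class_degree (a + b) = class_degree a + class_degree b"
  by (transfer; simp)+

subsection \<open>The Grothendieck ring\<close>

text \<open>
  A pair stands for the formal difference of its components. Since exact sequences of
  complex representations of a finite group split, the relations given by short exact
  sequences are the ones given by direct sums.
\<close>

definition same_difference :: "rep_class \<times> rep_class \<Rightarrow> rep_class \<times> rep_class \<Rightarrow> bool" where
  "same_difference = (\<lambda>(a, b) (c, d). \<exists>u. a + d + u = c + b + u)"

lemma same_difference_equivp: "equivp same_difference"
proof (rule equivpI)
  show "reflp same_difference" by (auto intro!: reflpI simp: same_difference_def)
  show "symp same_difference" by (rule sympI) (auto simp: same_difference_def dest: sym)
  show "transp same_difference"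
  proof (rule transpI)
    fix x y z assume "same_difference x y" "same_difference y z"
    then obtain a b c d e f u v where xyz: "x = (a, b)" "y = (c, d)" "z = (e, f)"
      and u: "a + d + u = c + b + u" and v: "c + f + v = e + d + v"
      by (cases x, cases y, cases z) (auto simp: same_difference_def)
    have "a + f + (c + d + u + v) = (a + d + u) + (c + f + v)" by (simp add: ac_simps)
    also have "\<dots> = (c + b + u) + (e + d + v)" using u v by simp
    also have "\<dots> = e + b + (c + d + u + v)" by (simp add: ac_simps)
    finally show "same_difference x z" by (auto simp: same_difference_def xyz)
  qed
qed

quotient_type rep_ring = "rep_class \<times> rep_class" / same_difference
  by (rule same_difference_equivp)

instantiation rep_ring :: comm_ring_1
begin

lift_definition zero_rep_ring :: rep_ring is "(0, 0)" .
lift_definition one_rep_ring :: rep_ring is "(1, 0)" .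
lift_definition plus_rep_ring :: "rep_ring \<Rightarrow> rep_ring \<Rightarrow> rep_ring" is
  "\<lambda>(a, b) (c, d). (a + c, b + d)"
proof -
  fix p p' q q' assume "same_difference p p'" "same_difference q q'"
  then obtain a b a' b' c d c' d' u v where pq: "p = (a, b)" "p' = (a', b')" "q = (c, d)" "q' = (c', d')"
    and u: "a + b' + u = a' + b + u" and v: "c + d' + v = c' + d + v"
    by (cases p, cases p', cases q, cases q') (auto simp: same_difference_def)
  have "(a + c) + (b' + d') + (u + v) = (a + b' + u) + (c + d' + v)" by (simp add: ac_simps)
  also have "\<dots> = (a' + b + u) + (c' + d + v)" using u v by simp
  also have "\<dots> = (a' + c') + (b + d) + (u + v)" by (simp add: ac_simps)
  finally show "same_difference ((case p of (a, b) \<Rightarrow> \<lambda>(c, d). (a + c, b + d)) q)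
      ((case p' of (a, b) \<Rightarrow> \<lambda>(c, d). (a + c, b + d)) q')"
    by (auto simp: same_difference_def pq)
qed
lift_definition uminus_rep_ring :: "rep_ring \<Rightarrow> rep_ring" is "\<lambda>(a, b). (b, a)"
proof -
  fix p q assume *: "same_difference p q"
  obtain a b c d where pq: "p = (a, b)" "q = (c, d)" by (cases p, cases q)
  obtain u where u: "a + d + u = c + b + u" using * unfolding pq same_difference_def by auto
  have "b + c + u = c + b + u" by (simp only: add.commute[of b c])
  also have "\<dots> = d + a + u" by (simp only: u[symmetric] add.commute[of a d])
  finally show "same_difference (case p of (a, b) \<Rightarrow> (b, a)) (case q of (a, b) \<Rightarrow> (b, a))"
    unfolding pq same_difference_def by auto
qed
definition minus_rep_ring :: "rep_ring \<Rightarrow> rep_ring \<Rightarrow> rep_ring" where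
  "x - y = x + - (y :: rep_ring)"
lift_definition times_rep_ring :: "rep_ring \<Rightarrow> rep_ring \<Rightarrow> rep_ring" is
  "\<lambda>(a, b) (c, d). (a * c + b * d, a * d + b * c)"
proof -
  have left: "same_difference (a * c + b * d, a * d + b * c) (a' * c + b' * d, a' * d + b' * c)"
    if *: "same_difference (a, b) (a', b')" for a b a' b' c d
  proof -
    obtain u where u: "a + b' + u = a' + b + u" using * by (auto simp: same_difference_def)
    have "(a * c + b * d) + (a' * d + b' * c) + (u * c + u * d) = (a + b' + u) * c + (a' + b + u) * d"
      by (simp add: algebra_simps)
    also have "\<dots> = (a' + b + u) * c + (a + b' + u) * d" using u by simp
    also have "\<dots> = (a' * c + b' * d) + (a * d + b * c) + (u * c + u * d)" by (simp add: algebra_simps)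
    finally show ?thesis unfolding same_difference_def by blast
  qed
  have right: "same_difference (a * c + b * d, a * d + b * c) (a * c' + b * d', a * d' + b * c')"
    if "same_difference (c, d) (c', d')" for a b c d c' d'
    using left[OF that, of a b] by (simp add: ac_simps)
  fix p p' q q' assume *: "same_difference p p'" "same_difference q q'"
  obtain a b a' b' c d c' d' where pq: "p = (a, b)" "p' = (a', b')" "q = (c, d)" "q' = (c', d')"
    by (cases p, cases p', cases q, cases q')
  show "same_difference ((case p of (a, b) \<Rightarrow> \<lambda>(c, d). (a * c + b * d, a * d + b * c)) q)
      ((case p' of (a, b) \<Rightarrow> \<lambda>(c, d). (a * c + b * d, a * d + b * c)) q')"
    unfolding pq prod.case
    using left[OF *(1)[unfolded pq]] right[OF *(2)[unfolded pq]]
    by (rule equivp_transp[OF same_difference_equivp])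
qed

instance
proof
  have eqI: "same_difference p q" if "p = q" for p q
    using that same_difference_equivp by (simp add: equivp_reflp)
  fix a b c :: rep_ring
  show "a + b + c = a + (b + c)" by transfer (auto intro!: eqI simp: ac_simps)
  show "a + b = b + a" by transfer (auto intro!: eqI simp: ac_simps)
  show "0 + a = a" by transfer (auto intro!: eqI)
  show "- a + a = 0" by transfer (auto simp: same_difference_def ac_simps)
  show "a - b = a + - b" by (rule minus_rep_ring_def)
  show "a * b * c = a * (b * c)" by transfer (auto intro!: eqI simp: algebra_simps)
  show "a * b = b * a" by transfer (auto intro!: eqI simp: ac_simps)
  show "1 * a = a" by transfer (auto intro!: eqI)
  show "(a + b) * c = a * c + b * c" by transfer (auto intro!: eqI simp: algebra_simps)
  show "(0::rep_ring) \<noteq> 1"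
    by transfer (auto simp: same_difference_def dest!: arg_cong[where f = class_degree])
qed

end

lift_definition rep_ring_of :: "s4_rep \<Rightarrow> rep_ring" is "\<lambda>V. (abs_rep_class V, 0)" .

subsection \<open>The irreducible representations\<close>

text \<open>
  Permutation matrices of degree \<open>n + 1\<close>, restricted to the subspace of vectors with
  coordinate sum \<open>0\<close> and written in the basis \<open>e\<^sub>i - e\<^sub>n\<^sub>+\<^sub>1\<close> (\<open>i = 1, \<dots>, n\<close>).
\<close>

definition standard_matrix :: "nat \<Rightarrow> (nat \<Rightarrow> nat) \<Rightarrow> complex mat" where
  "standard_matrix n g = mat n n (\<lambda>(i, j). of_bool (g (Suc j) = Suc i) - of_bool (g (Suc n) = Suc i))"

lemma standard_matrix_id: "standard_matrix n id = 1\<^sub>m n"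
  by (rule eq_matI) (auto simp: standard_matrix_def)

lemma standard_matrix_comp:
  assumes g: "g permutes {1..Suc n}" and h: "h permutes {1..Suc n}"
  shows "standard_matrix n (g \<circ> h) = standard_matrix n g * standard_matrix n h"
proof (rule eq_matI)
  fix i j assume "i < dim_row (standard_matrix n g * standard_matrix n h)"
    "j < dim_col (standard_matrix n g * standard_matrix n h)"
  then have ij: "i < n" "j < n" by (auto simp: standard_matrix_def)
  define a :: "nat \<Rightarrow> complex" where "a k = of_bool (g k = Suc i) - of_bool (g (Suc n) = Suc i)" for k
  have *: "(\<Sum>k<n. a (Suc k) * of_bool (l = Suc k)) = a l" if "l \<in> {1..Suc n}" for l
  proof (cases "l = Suc n")
    case False
    then have "l = Suc (l - 1)" "l - 1 < n" using that by auto
    then obtain m where m: "l = Suc m" "m < n" by blast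
    have "(\<Sum>k<n. a (Suc k) * of_bool (l = Suc k)) = (\<Sum>k<n. if k = m then a (Suc k) else 0)"
      using m by (intro sum.cong) auto
    then show ?thesis using m by simp
  qed (simp add: a_def)
  have mem: "h (Suc j) \<in> {1..Suc n}" "h (Suc n) \<in> {1..Suc n}"
    using ij permutes_in_image[OF h, of "Suc j"] permutes_in_image[OF h, of "Suc n"] by auto
  have "(standard_matrix n g * standard_matrix n h) $$ (i, j) =
      (\<Sum>k<n. a (Suc k) * (of_bool (h (Suc j) = Suc k) - of_bool (h (Suc n) = Suc k)))"
    using ij by (simp add: standard_matrix_def scalar_prod_def atLeast0LessThan a_def)
  also have "\<dots> = (\<Sum>k<n. a (Suc k) * of_bool (h (Suc j) = Suc k)) -
      (\<Sum>k<n. a (Suc k) * of_bool (h (Suc n) = Suc k))"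
    by (simp only: right_diff_distrib sum_subtractf)
  also have "\<dots> = a (h (Suc j)) - a (h (Suc n))" by (simp only: *[OF mem(1)] *[OF mem(2)])
  also have "\<dots> = standard_matrix n (g \<circ> h) $$ (i, j)"
    using ij by (simp add: standard_matrix_def a_def)
  finally show "standard_matrix n (g \<circ> h) $$ (i, j) = (standard_matrix n g * standard_matrix n h) $$ (i, j)"
    by simp
qed (auto simp: standard_matrix_def)

text \<open>
  The two-dimensional representation is the standard representation of \<open>S\<^sub>3\<close>, pulled back
  along the action of \<open>S\<^sub>4\<close> on the three partitions of \<open>{1, 2, 3, 4}\<close> into pairs.
\<close>

definition pairing :: "nat \<Rightarrow> nat set set" where
  "pairing k = {{k, 4}, {1..4} - {k, 4}}"

definition pairing_action :: "(nat \<Rightarrow> nat) \<Rightarrow> nat \<Rightarrow> nat" where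
  "pairing_action g k =
     (if k \<in> {1..3} then THE l. l \<in> {1..3} \<and> pairing l = (`) g ` pairing k else k)"

lemma pairing_eq:
  assumes "a \<noteq> b" "a \<in> {1..4}" "b \<in> {1..4}"
  shows "\<exists>l\<in>{1..3}. pairing l = {{a, b}, {1..4} - {a, b}}"
proof -
  have 4: "{1..4} = {1, 2, 3, 4::nat}" by auto
  consider "b = 4" | "a = 4" | "a \<noteq> 4" "b \<noteq> 4" by blast
  then show ?thesis
  proof cases
    case 1 then show ?thesis using assms by (intro bexI[of _ a]) (auto simp: pairing_def)
  next
    case 2 then show ?thesis using assms
      by (intro bexI[of _ b]) (auto simp: pairing_def insert_commute)
  next
    case 3
    then have "a \<in> {1, 2, 3}" "b \<in> {1, 2, 3}" using assms by auto
    then have "\<exists>c. c \<in> {1..3} \<and> c \<noteq> a \<and> c \<noteq> b \<and> {1, 2, 3} = {a, b, c}"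
      using assms(1) by (intro exI[of _ "6 - a - b"]) auto
    then obtain c where c: "c \<in> {1..3}" "c \<noteq> a" "c \<noteq> b" and 3: "{1, 2, 3} = {a, b, c}" by blast
    have "{1..4} = {1, 2, 3} \<union> {4::nat}" unfolding 4 by (simp only: Un_insert_left Un_empty_left)
    then have abc: "{1..4} = {a, b, c, 4}" unfolding 3 by (simp only: Un_insert_left Un_empty_left)
    have "{1..4} - {a, b} = {c, 4}" "{1..4} - {c, 4} = {a, b}"
      unfolding abc using c assms(1) \<open>a \<noteq> 4\<close> \<open>b \<noteq> 4\<close> by auto
    then have "pairing c = {{a, b}, {1..4} - {a, b}}" by (simp add: pairing_def insert_commute)
    then show ?thesis using c(1) by blast
  qed
qed

lemma pairing_inj: "inj_on pairing {1..3}"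
proof (rule inj_onI)
  fix k l assume kl: "k \<in> {1..3}" "l \<in> {1..3}" "pairing k = pairing l"
  have "{k, 4} \<in> pairing l" unfolding kl(3)[symmetric] by (simp add: pairing_def)
  moreover have "{k, 4} \<noteq> {1..4} - {l, 4}" by blast
  ultimately have "{k, 4} = {l, 4}" unfolding pairing_def by blast
  then show "k = l" unfolding doubleton_eq_iff by blast
qed

lemma pairing_action:
  assumes g: "g permutes {1..4}" and k: "k \<in> {1..3}"
  shows "pairing_action g k \<in> {1..3}" "pairing (pairing_action g k) = (`) g ` pairing k"
proof -
  have inj: "inj g" using g by (rule permutes_inj)
  have "(`) g ` pairing k = {{g k, g 4}, {1..4} - {g k, g 4}}"
    using permutes_image[OF g] by (simp add: pairing_def image_set_diff[OF inj])
  moreover have "g k \<noteq> g 4" using k by (simp add: inj_eq[OF inj])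
  moreover have "g k \<in> {1..4}" "g 4 \<in> {1..4}"
    using k permutes_in_image[OF g, of k] permutes_in_image[OF g, of 4] by auto
  ultimately have "\<exists>l\<in>{1..3}. pairing l = (`) g ` pairing k"
    using pairing_eq[of "g k" "g 4"] by simp
  then have "\<exists>!l. l \<in> {1..3} \<and> pairing l = (`) g ` pairing k"
    by (intro ex_ex1I) (blast, metis inj_onD[OF pairing_inj])
  from theI'[OF this] show "pairing_action g k \<in> {1..3}"
    "pairing (pairing_action g k) = (`) g ` pairing k"
    using k by (simp_all add: pairing_action_def)
qed

lemma pairing_action_eqI:
  assumes "g permutes {1..4}" "k \<in> {1..3}" "l \<in> {1..3}" "pairing l = (`) g ` pairing k"
  shows "pairing_action g k = l"
  using pairing_action[OF assms(1,2)] assms(3,4) by (intro inj_onD[OF pairing_inj]) simp_all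

lemma pairing_action_id: "pairing_action id = id"
proof
  fix k show "pairing_action id k = id k"
  proof (cases "k \<in> {1..3}")
    case True
    then show ?thesis by (intro pairing_action_eqI permutes_id) simp_all
  next
    case False
    then show ?thesis by (auto simp: pairing_action_def)
  qed
qed

lemma pairing_action_comp:
  assumes "g permutes {1..4}" "h permutes {1..4}"
  shows "pairing_action (g \<circ> h) = pairing_action g \<circ> pairing_action h"
proof
  fix k show "pairing_action (g \<circ> h) k = (pairing_action g \<circ> pairing_action h) k"
  proof (cases "k \<in> {1..3}")
    case True
    note h = pairing_action[OF assms(2) True]
    have "pairing_action (g \<circ> h) k = pairing_action g (pairing_action h k)"
    proof (rule pairing_action_eqI)
      show "g \<circ> h permutes {1..4}" using assms(2,1) by (rule permutes_compose)
      show "pairing_action g (pairing_action h k) \<in> {1..3}"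
        "pairing (pairing_action g (pairing_action h k)) = (`) (g \<circ> h) ` pairing k"
        using pairing_action[OF assms(1) h(1)] by (simp_all add: h(2) image_image image_comp comp_def)
    qed (rule True)
    then show ?thesis by simp
  next
    case False
    then show ?thesis by (auto simp: pairing_action_def)
  qed
qed

lemma pairing_action_permutes:
  assumes g: "g permutes {1..4}"
  shows "pairing_action g permutes {1..3}"
proof (rule bij_imp_permutes)
  have g': "inv' g permutes {1..4}" using g by (rule permutes_inv)
  have "pairing_action (inv' g) \<circ> pairing_action g = id" "pairing_action g \<circ> pairing_action (inv' g) = id"
    using pairing_action_comp[OF g' g] pairing_action_comp[OF g g']
    by (simp_all add: permutes_inv_o[OF g] pairing_action_id)
  then show "bij_betw (pairing_action g) {1..3} {1..3}"
    using pairing_action(1)[OF g] pairing_action(1)[OF g']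
    by (intro bij_betw_byWitness[where f' = "pairing_action (inv' g)"]) (auto simp: fun_eq_iff)
qed (auto simp: pairing_action_def)

lift_definition sign_rep :: s4_rep is "(1, \<lambda>g. mat 1 1 (\<lambda>_. of_int (sign g)))"
proof -
  have "is_representation 1 (\<lambda>g. mat 1 1 (\<lambda>_. of_int (sign g)))"
  proof (rule is_representationI)
    fix g h :: "nat \<Rightarrow> nat" assume "g permutes {1..4}" "h permutes {1..4}"
    then have "sign (g \<circ> h) = sign g * sign h"
      by (intro sign_compose) (auto simp: permutation_permutes)
    then show "mat 1 1 (\<lambda>_. of_int (sign (g \<circ> h))) =
        (mat 1 1 (\<lambda>_. of_int (sign g)) * mat 1 1 (\<lambda>_. of_int (sign h)) :: complex mat)"
      by (intro eq_matI) (auto simp: scalar_prod_def)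
  qed (auto intro: eq_matI)
  then show ?thesis by simp
qed

lift_definition two_dim_rep :: s4_rep is "(2, \<lambda>g. standard_matrix 2 (pairing_action g))"
proof -
  have "is_representation 2 (\<lambda>g. standard_matrix 2 (pairing_action g))"
  proof (rule is_representationI)
    fix g h :: "nat \<Rightarrow> nat" assume g: "g permutes {1..4}" and h: "h permutes {1..4}"
    have *: "pairing_action g permutes {1..Suc 2}" "pairing_action h permutes {1..Suc 2}"
      using g[THEN pairing_action_permutes] h[THEN pairing_action_permutes]
      by (simp_all add: numeral_3_eq_3 numeral_2_eq_2)
    show "standard_matrix 2 (pairing_action (g \<circ> h)) =
        standard_matrix 2 (pairing_action g) * standard_matrix 2 (pairing_action h)"
      unfolding pairing_action_comp[OF g h] using * by (rule standard_matrix_comp)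
  qed (simp_all add: pairing_action_id standard_matrix_id, simp add: standard_matrix_def)
  then show ?thesis by simp
qed

lift_definition standard_rep :: s4_rep is "(3, standard_matrix 3)"
proof -
  have "is_representation 3 (standard_matrix 3)"
  proof (rule is_representationI)
    fix g h :: "nat \<Rightarrow> nat" assume "g permutes {1..4}" "h permutes {1..4}"
    then show "standard_matrix 3 (g \<circ> h) = standard_matrix 3 g * standard_matrix 3 h"
      by (intro standard_matrix_comp) simp_all
  qed (simp_all add: standard_matrix_id, simp add: standard_matrix_def)
  then show ?thesis by simp
qed

definition V_psi :: rep_ring where "V_psi = rep_ring_of sign_rep"

definition V_rho1 :: rep_ring where "V_rho1 = rep_ring_of two_dim_rep"

definition V_rho2 :: rep_ring where "V_rho2 = rep_ring_of standard_rep"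

definition V_rho3 :: rep_ring where "V_rho3 = V_psi * V_rho2"

definition irreducible_classes :: "rep_ring set" where
  "irreducible_classes = {1, V_psi, V_rho1, V_rho2, V_rho3}"

section \<open>Based modules\<close>

text \<open>
  A module over the representation ring is given by its scalar multiplication \<open>smul\<close> (on a whole
  type); its underlying \<open>\<int>\<close>-module is obtained by restricting scalars along \<open>of_int\<close>.
\<close>

abbreviation int_smul :: "(rep_ring \<Rightarrow> 'm \<Rightarrow> 'm) \<Rightarrow> int \<Rightarrow> 'm::ab_group_add \<Rightarrow> 'm" where
  "int_smul smul \<equiv> (\<lambda>k. smul (of_int k))"

definition Z_basis :: "(rep_ring \<Rightarrow> 'm \<Rightarrow> 'm) \<Rightarrow> 'm::ab_group_add set \<Rightarrow> bool" where
  "Z_basis smul B \<longleftrightarrow>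
     \<not> module.dependent (int_smul smul) B \<and> module.span (int_smul smul) B = UNIV"

text \<open>The coefficient of \<open>k\<close> in the expansion of \<open>r l\<close> in the basis \<open>B\<close>.\<close>

definition structure_constant ::
    "(rep_ring \<Rightarrow> 'm \<Rightarrow> 'm) \<Rightarrow> 'm::ab_group_add set \<Rightarrow> rep_ring \<Rightarrow> 'm \<Rightarrow> 'm \<Rightarrow> int" where
  "structure_constant smul B r l k = module.representation (int_smul smul) B (smul r l) k"

definition Zplus_module :: "(rep_ring \<Rightarrow> 'm \<Rightarrow> 'm) \<Rightarrow> 'm::ab_group_add set \<Rightarrow> bool" where
  "Zplus_module smul B \<longleftrightarrow> Modules.module smul \<and> Z_basis smul B \<and>
     (\<forall>r\<in>irreducible_classes. \<forall>l\<in>B. \<forall>k\<in>B. 0 \<le> structure_constant smul B r l k)"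

text \<open>All irreducible representations of \<open>S\<^sub>4\<close> are self-dual, so no dual appears on the right.\<close>

definition based_module :: "(rep_ring \<Rightarrow> 'm \<Rightarrow> 'm) \<Rightarrow> 'm::ab_group_add set \<Rightarrow> bool" where
  "based_module smul B \<longleftrightarrow> Zplus_module smul B \<and>
     (\<forall>r\<in>irreducible_classes. \<forall>l\<in>B. \<forall>k\<in>B.
        structure_constant smul B r l k = structure_constant smul B r k l)"

definition irreducible_Zplus_module :: "(rep_ring \<Rightarrow> 'm \<Rightarrow> 'm) \<Rightarrow> 'm::ab_group_add set \<Rightarrow> bool" where
  "irreducible_Zplus_module smul B \<longleftrightarrow> Zplus_module smul B \<and> (\<exists>x::'m. x \<noteq> 0) \<and>
     \<not> (\<exists>S. S \<noteq> {} \<and> S \<subset> B \<and> module.subspace smul (module.span (int_smul smul) S))"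

definition Zplus_equivalent ::
    "(rep_ring \<Rightarrow> 'm \<Rightarrow> 'm) \<Rightarrow> 'm::ab_group_add set \<Rightarrow>
     (rep_ring \<Rightarrow> 'n \<Rightarrow> 'n) \<Rightarrow> 'n::ab_group_add set \<Rightarrow> bool" where
  "Zplus_equivalent smul B smul' B' \<longleftrightarrow>
     (\<exists>F. Modules.module_hom smul smul' F \<and> bij F \<and> bij_betw F B B')"

text \<open>
  A based module structure on \<open>\<int>\<^sup>3\<close> with its standard basis in which \<open>V_psi\<close>, \<open>V_rho1\<close>, \<open>V_rho2\<close>
  act by the matrices \<open>A\<close>, \<open>P\<close>, \<open>R\<close>.
\<close>

definition based_module_given_by ::
    "(rep_ring \<Rightarrow> (int^3) \<Rightarrow> (int^3)) \<Rightarrow> (int^3^3) \<times> (int^3^3) \<times> (int^3^3) \<Rightarrow> bool" where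
  "based_module_given_by smul = (\<lambda>(A, P, R).
     based_module smul cart_basis \<and>
     smul V_psi = (*v) A \<and> smul V_rho1 = (*v) P \<and> smul V_rho2 = (*v) R \<and>
     smul V_rho3 = (*v) (A ** R))"

definition M31 :: "(int^3^3) \<times> (int^3^3) \<times> (int^3^3)" where
  "M31 =
    (vector [vector [1, 0, 0],
             vector [0, 1, 0],
             vector [0, 0, 1]],
     vector [vector [0, 1, 1],
             vector [1, 0, 1],
             vector [1, 1, 0]],
     vector [vector [1, 1, 1],
             vector [1, 1, 1],
             vector [1, 1, 1]])"

definition M32 :: "(int^3^3) \<times> (int^3^3) \<times> (int^3^3)" where
  "M32 =
    (vector [vector [0, 1, 0],
             vector [1, 0, 0],
             vector [0, 0, 1]],
     vector [vector [0, 0, 1],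
             vector [0, 0, 1],
             vector [1, 1, 1]],
     vector [vector [1, 0, 1],
             vector [0, 1, 1],
             vector [1, 1, 2]])"

definition M33 :: "(int^3^3) \<times> (int^3^3) \<times> (int^3^3)" where
  "M33 =
    (vector [vector [0, 1, 0],
             vector [1, 0, 0],
             vector [0, 0, 1]],
     vector [vector [0, 0, 1],
             vector [0, 0, 1],
             vector [1, 1, 1]],
     vector [vector [0, 1, 1],
             vector [1, 0, 1],
             vector [1, 1, 2]])"

end

(*
  Every class in the representation ring is an integer combination of 1, V_psi, V_rho1, V_rho2
  and V_rho3: in a representation V, a subrepresentation that is a sum of irreducibles and has
  maximal dimension has an invariant complement, and if that complement were nonzero, averaging
  matrix units over the group (Schur orthogonality together with the second orthogonality
  relation at the identity) would split off another irreducible. Characters then give the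
  multiplication table of the ring.

  In a based module of rank 3, V_psi acts by a symmetric non-negative matrix of square 1, hence by
  the identity or by a transposition of basis elements. The diagonal entries of the relations for
  V_rho1^2 and V_rho2^2 bound sums of squares of the remaining entries, which leaves finitely many
  matrices; those with an invariant basis element are excluded by irreducibility, because a
  subset of the basis stable under the five irreducible classes is stable under the whole ring.
*)
theory Submission
  imports Defs "Jordan_Normal_Form.Determinant"
begin

section \<open>Orthogonality relations\<close>

text \<open>\<open>rep_ring\<close> consists of formal differences of isomorphism classes of matrix
  representations, with no presentation given, and a submodule must be stable under all of it. Hence
  both the generation by five classes and the multiplication table are theorems here. No isomorphism
  between tensor products is ever written down: a class is a natural combination of the five
  irreducible ones, the five-by-five character table is invertible, and so an identity of classes is
  a comparison of five numbers. That there is no sixth irreducible is encoded in the character of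
  the regular representation, which vanishes off the identity. Orthogonality of matrix entries is
  double transitivity in disguise: S_4 acts doubly transitively on four points and, through the
  pairings, on three. Symmetry of the matrices makes the complement of a stable set of basis
  elements stable. In rank 3 irreducibility is therefore a condition on single basis
  elements.\<close>

lemma sum_of_bool_eq:
  assumes "finite S" "x \<in> S"
  shows "(\<Sum>b\<in>S. of_bool (x = b)) = (1 :: 'a :: semiring_1)"
proof -
  have "(\<Sum>b\<in>S. of_bool (x = b)) = (\<Sum>b\<in>S. if b = x then 1 else (0::'a))" by (rule sum.cong) auto
  then show ?thesis using assms by simp
qed

text \<open>Covers both the action of \<open>S\<^sub>4\<close> on \<open>{1..4}\<close> and its action on the three pairings.\<close>

locale transposition_equivariant =
  fixes S :: "nat set" and \<phi> :: "(nat \<Rightarrow> nat) \<Rightarrow> nat \<Rightarrow> nat"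
  assumes subset: "S \<subseteq> {1..4}"
    and permutes: "g permutes {1..4} \<Longrightarrow> \<phi> g permutes S"
    and equivariant: "g permutes {1..4} \<Longrightarrow> b \<in> S \<Longrightarrow> c \<in> S \<Longrightarrow>
      \<phi> (Transposition.transpose b c \<circ> g) = Transposition.transpose b c \<circ> \<phi> g"
begin

lemma finite: "finite S"
  using subset finite_subset by blast

text \<open>Reindex the sum over the group by left multiplication with the transposition of
  \<open>b\<close> and \<open>c\<close>; equivariance pulls it out of \<open>\<phi>\<close>.\<close>

lemma sum_transpose:
  assumes "b \<in> S" "c \<in> S"
  shows "(\<Sum>g | g permutes {1..4}. f (Transposition.transpose b c \<circ> \<phi> g)) = (\<Sum>g | g permutes {1..4}. f (\<phi> g))"
proof -
  have "Transposition.transpose b c permutes {1..4}" using assms subset by (intro permutes_swap_id) auto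
  from setum_permutations_compose_left[OF this, of "\<lambda>g. f (\<phi> g)"]
  show ?thesis using assms by (simp add: equivariant)
qed

text \<open>By \<open>sum_transpose\<close> the count is the same for every value \<open>b\<close>,
  and over all \<open>b\<close> in \<open>S\<close> the counts add up to the group order 24.\<close>

lemma count_1:
  assumes "a \<in> S" "b \<in> S"
  shows "of_nat (card S) * (\<Sum>g | g permutes {1..4}. of_bool (\<phi> g a = b)) = (24 :: 'a :: field_char_0)"
proof -
  define M where "M b = (\<Sum>g | g permutes {1..4}. of_bool (\<phi> g a = b) :: 'a)" for b
  have M_eq: "M c = M b" if "c \<in> S" for c
  proof -
    have "Transposition.transpose b c x = b \<longleftrightarrow> x = c" for x by (auto simp: Transposition.transpose_def)
    then show ?thesis unfolding M_def using sum_transpose[OF assms(2) that, of "\<lambda>p. of_bool (p a = b) :: 'a"]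
      by simp
  qed
  have "(\<Sum>c\<in>S. M c) = (\<Sum>g | g permutes {1..4}. \<Sum>c\<in>S. of_bool (\<phi> g a = c))"
    unfolding M_def by (rule sum.swap)
  also have "\<dots> = (\<Sum>g | g permutes {1..4::nat}. 1)"
  proof (rule sum.cong[OF refl])
    fix g :: "nat \<Rightarrow> nat" assume "g \<in> {g. g permutes {1..4}}"
    then have "\<phi> g a \<in> S" using assms(1) permutes_in_image[OF permutes] by blast
    then show "(\<Sum>c\<in>S. of_bool (\<phi> g a = c)) = (1::'a)" by (intro sum_of_bool_eq finite)
  qed
  also have "\<dots> = 24" by (simp add: card_permutations[OF refl] fact_numeral)
  finally show ?thesis using M_eq by (simp add: M_def)
qed

text \<open>Double transitivity as a count. For \<open>a \<noteq> c\<close> and fixed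
  \<open>b\<close>, a transposition of two values other than \<open>b\<close> exchanges their
  counts, so the elements with \<open>\<phi> g a = b\<close> are spread evenly over the
  \<open>n\<close> remaining values of \<open>\<phi> g c\<close>.\<close>

lemma count_2:
  assumes "a \<in> S" "b \<in> S" "c \<in> S" "e \<in> S" and n: "card S = Suc n" "n > 0"
  shows "(\<Sum>g | g permutes {1..4}. of_bool (\<phi> g a = b) * of_bool (\<phi> g c = e)) =
    (if a = c then of_bool (b = e) * (24 / of_nat (Suc n)) else of_bool (b \<noteq> e) * (24 / of_nat (Suc n) / of_nat n)
      :: 'a :: field_char_0)"
proof -
  have one: "(\<Sum>g | g permutes {1..4}. of_bool (\<phi> g a = b)) = (24 / of_nat (Suc n) :: 'a)"
    using count_1[OF assms(1,2), where 'a = 'a] n by (metis nonzero_mult_div_cancel_left of_nat_0_neq)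
  consider (1) "a = c" | (2) "a \<noteq> c" "b = e" | (3) "a \<noteq> c" "b \<noteq> e" by blast
  then show ?thesis
  proof cases
    case 1
    then have "(\<Sum>g | g permutes {1..4}. of_bool (\<phi> g a = b) * of_bool (\<phi> g c = e)) =
      (\<Sum>g | g permutes {1..4}. of_bool (b = e) * (of_bool (\<phi> g a = b) :: 'a))"
      by (intro sum.cong) auto
    then show ?thesis using 1 one by (simp flip: sum_distrib_left)
  next
    case 2
    have "of_bool (\<phi> g a = b) * of_bool (\<phi> g c = e) = (0::'a)" if "g permutes {1..4}" for g
      using 2 inj_eq[OF permutes_inj[OF permutes[OF that]], of a c] by auto
    then have "(\<Sum>g | g permutes {1..4}. of_bool (\<phi> g a = b) * of_bool (\<phi> g c = e)) = (0::'a)"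
      by (intro sum.neutral) blast
    then show ?thesis using 2 by (simp del: One_nat_def)
  next
    case 3
    define N where "N e = (\<Sum>g | g permutes {1..4}. of_bool (\<phi> g a = b) * of_bool (\<phi> g c = e) :: 'a)" for e
    have N_eq: "N d = N e" if "d \<in> S - {b}" for d
    proof -
      have "Transposition.transpose e d x = e \<longleftrightarrow> x = d" "Transposition.transpose e d x = b \<longleftrightarrow> x = b" for x
        using that 3 by (auto simp: Transposition.transpose_def)
      then show ?thesis unfolding N_def
        using sum_transpose[OF assms(4), of d "\<lambda>p. of_bool (p a = b) * of_bool (p c = e) :: 'a"] that by simp
    qed
    have "(\<Sum>d\<in>S-{b}. N d) = (\<Sum>g | g permutes {1..4}. \<Sum>d\<in>S-{b}. of_bool (\<phi> g a = b) * of_bool (\<phi> g c = d))"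
      unfolding N_def by (rule sum.swap)
    also have "\<dots> = (\<Sum>g | g permutes {1..4::nat}. of_bool (\<phi> g a = b))"
    proof (rule sum.cong[OF refl])
      fix g :: "nat \<Rightarrow> nat" assume g: "g \<in> {g. g permutes {1..4}}"
      have "(\<Sum>d\<in>S-{b}. of_bool (\<phi> g c = d)) = (1::'a)" if "\<phi> g a = b"
      proof -
        have "\<phi> g c \<in> S" using g assms(3) permutes_in_image[OF permutes] by blast
        moreover have "\<phi> g c \<noteq> b" using g that 3 inj_eq[OF permutes_inj[OF permutes], of g a c] by auto
        ultimately show ?thesis by (intro sum_of_bool_eq) (auto simp: finite)
      qed
      then show "(\<Sum>d\<in>S-{b}. of_bool (\<phi> g a = b) * of_bool (\<phi> g c = d)) = (of_bool (\<phi> g a = b) :: 'a)"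
        by (auto simp flip: sum_distrib_left)
    qed
    also have "\<dots> = 24 / of_nat (Suc n)" by (rule one)
    finally have "of_nat n * N e = 24 / of_nat (Suc n)" using N_eq assms(2) n by (simp add: card_Diff_singleton)
    then have "N e = 24 / of_nat (Suc n) / of_nat n" using n(2) by (metis nonzero_mult_div_cancel_left of_nat_0_eq_iff less_numeral_extra(3))
    then show ?thesis using 3 unfolding N_def by simp
  qed
qed

end

text \<open>Entries of the inverse become indicators in \<open>g\<close> itself, which brings the
  products in Schur orthogonality into the form counted by \<open>count_2\<close>.\<close>

lemma standard_matrix_inv:
  assumes "g permutes {1..Suc n}" "i < n" "j < n"
  shows "standard_matrix n (inv' g) $$ (i, j) = of_bool (g (Suc i) = Suc j) - of_bool (g (Suc i) = Suc n)"
  using assms(2,3) by (auto simp: standard_matrix_def permutes_inv_eq[OF assms(1)])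

text \<open>Expanding the two differences of indicators gives four counts from
  \<open>count_2\<close>, which cancel unless \<open>i = l\<close> and \<open>j = k\<close>. The
  factor \<open>n\<close> is the dimension, one less than the number of points.\<close>

lemma schur_orthogonality_standard:
  assumes "transposition_equivariant {1..Suc n} \<phi>" and ijkl: "i < n" "j < n" "k < n" "l < n"
  shows "of_nat n * (\<Sum>g | g permutes {1..4}. standard_matrix n (inv' (\<phi> g)) $$ (i, j) * standard_matrix n (\<phi> g) $$ (k, l)) =
    of_bool (i = l \<and> j = k) * 24"
proof -
  interpret transposition_equivariant "{1..Suc n}" \<phi> by fact
  note count = count_2[where n = n and 'a = complex]
  have "(\<Sum>g | g permutes {1..4}. standard_matrix n (inv' (\<phi> g)) $$ (i, j) * standard_matrix n (\<phi> g) $$ (k, l)) =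
    (\<Sum>g | g permutes {1..4}. (of_bool (\<phi> g (Suc i) = Suc j) - of_bool (\<phi> g (Suc i) = Suc n)) *
      (of_bool (\<phi> g (Suc l) = Suc k) - of_bool (\<phi> g (Suc n) = Suc k)))"
    by (rule sum.cong[OF refl], subst standard_matrix_inv[OF permutes])
      (use ijkl in \<open>auto simp: standard_matrix_def\<close>)
  also have "\<dots> = of_bool (i = l \<and> j = k) * (24 / of_nat (Suc n) + 24 / of_nat (Suc n) / of_nat n)"
    using ijkl by (simp add: right_diff_distrib left_diff_distrib sum_subtractf count del: One_nat_def)
  finally have "of_nat n * (\<Sum>g | g permutes {1..4}. standard_matrix n (inv' (\<phi> g)) $$ (i, j) * standard_matrix n (\<phi> g) $$ (k, l)) =
    of_bool (i = l \<and> j = k) * (of_nat n * (24 / of_nat (Suc n) + 24 / of_nat (Suc n) / of_nat n))"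
    by (simp only: ac_simps)
  also have "of_nat n * (24 / of_nat (Suc n) + 24 / of_nat (Suc n) / of_nat n) = (24 :: complex)"
  proof -
    have "of_nat n \<noteq> (0 :: complex)" "1 + of_nat n \<noteq> (0 :: complex)"
      using ijkl by (simp, metis of_nat_Suc of_nat_neq_0)
    then show ?thesis by (simp add: divide_simps)
  qed
  finally show ?thesis .
qed

section \<open>The elements of S_4 and the regular character\<close>

lemma permutes_insertE:
  assumes "g permutes insert a S"
  obtains b p where "b \<in> insert a S" "p permutes S" "g = Transposition.transpose a b \<circ> p"
proof -
  have "g \<in> {p. p permutes insert a S}" using assms by simp
  then obtain x where "x \<in> {(b, p). b \<in> insert a S \<and> p \<in> {p. p permutes S}}"
    "g = (\<lambda>(b, p). Transposition.transpose a b \<circ> p) x"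
    unfolding permutes_insert by (rule imageE)
  then show thesis using that[of "fst x" "snd x"] by (auto simp: case_prod_beta)
qed

text \<open>Peeling off one point at a time writes \<open>g\<close> as (1 b)(2 c)(3 d) with 4, 3 and
  2 choices, and each nontrivial factor contributes a sign -1. Identities in the values of
  \<open>g\<close> thereby become finite checks.\<close>

lemma permutes_4_values:
  assumes "g permutes {1..4::nat}"
  shows "(g 1, g 2, g 3, g 4, sign g) \<in> {
    (1, 2, 3, 4, 1), (1, 2, 4, 3, -1), (1, 3, 2, 4, -1), (1, 3, 4, 2, 1),
    (1, 4, 2, 3, 1), (1, 4, 3, 2, -1), (2, 1, 3, 4, -1), (2, 1, 4, 3, 1),
    (2, 3, 1, 4, 1), (2, 3, 4, 1, -1), (2, 4, 1, 3, -1), (2, 4, 3, 1, 1),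
    (3, 1, 2, 4, 1), (3, 1, 4, 2, -1), (3, 2, 1, 4, -1), (3, 2, 4, 1, 1),
    (3, 4, 1, 2, 1), (3, 4, 2, 1, -1), (4, 1, 2, 3, -1), (4, 1, 3, 2, 1),
    (4, 2, 1, 3, 1), (4, 2, 3, 1, -1), (4, 3, 1, 2, -1), (4, 3, 2, 1, 1)}"
proof -
  have 4: "{1..4} = {1, 2, 3, 4::nat}" by auto
  have "g permutes {1, 2, 3, 4}" using assms 4 by simp
  then obtain b p where b: "b \<in> {1,2,3,4}" and p: "p permutes {2,3,4}" and g: "g = Transposition.transpose 1 b \<circ> p"
    by (rule permutes_insertE)
  from p obtain c q where c: "c \<in> {2,3,4}" and q: "q permutes {3,4}" and p: "p = Transposition.transpose 2 c \<circ> q"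
    by (rule permutes_insertE)
  from q obtain d r where d: "d \<in> {3,4}" and r: "r permutes {4}" and q: "q = Transposition.transpose 3 d \<circ> r"
    by (rule permutes_insertE)
  from r have r: "r = id" by (simp add: permutes_sing)
  have sgn: "sign g = (if 1 = b then 1 else -1) * ((if 2 = c then 1 else -1) * (if 3 = d then 1 else -1))"
    unfolding g p q r comp_id
    by (simp only: sign_compose sign_swap_id permutation_compose permutation_swap_id)
  have val: "g x = Transposition.transpose 1 b (Transposition.transpose 2 c (Transposition.transpose 3 d x))" for x
    by (simp add: g p q r)
  show ?thesis using b c d unfolding sgn val
    by (elim insertE emptyE; hypsubst) (simp_all add: Transposition.transpose_def)
qed

text \<open>A pairing is labelled by the partner of 4. The block {k, 4} goes to {g k, g 4}; if this
  contains 4, the other element is the label. Otherwise 4 lies in the complementary block, and its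
  partner is the remaining element of {1, 2, 3}, obtained from 1 + 2 + 3 = 6.\<close>

lemma pairing_action_simp:
  assumes g: "g permutes {1..4}" and k: "k \<in> {1..3}"
  shows "pairing_action g k = (if g 4 = 4 then g k else if g k = 4 then g 4 else 6 - g k - g 4)"
proof -
  have inj: "inj g" using g by (rule permutes_inj)
  have mem: "g k \<in> {1..4}" "g 4 \<in> {1..4}"
    using k permutes_in_image[OF g, of k] permutes_in_image[OF g, of 4] by auto
  have ne: "g k \<noteq> g 4" using k by (simp add: inj_eq[OF inj])
  have im: "(`) g ` pairing k = {{g k, g 4}, {1..4} - {g k, g 4}}"
    using permutes_image[OF g] by (simp add: pairing_def image_set_diff[OF inj])
  have 4: "{1..4} = {1, 2, 3, 4::nat}" by auto
  show ?thesis
  proof (rule pairing_action_eqI[OF g k])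
    show "(if g 4 = 4 then g k else if g k = 4 then g 4 else 6 - g k - g 4) \<in> {1..3}"
      using mem ne unfolding 4 by auto
    have "pairing (6 - g k - g 4) = {{g k, g 4}, {1..4} - {g k, g 4}}" if "g k \<noteq> 4" "g 4 \<noteq> 4"
    proof -
      define x y where "x = g k" and "y = g 4"
      have xy: "x \<in> {1,2,3}" "y \<in> {1,2,3}" "x \<noteq> y" using mem that ne by (auto simp: x_def y_def)
      then have "{6 - x - y, 4} = {1..4} - {x, y}" "{1..4} - {6 - x - y, 4} = {x, y}" unfolding 4 by auto
      then show ?thesis by (auto simp: pairing_def x_def y_def)
    qed
    then show "pairing (if g 4 = 4 then g k else if g k = 4 then g 4 else 6 - g k - g 4) = (`) g ` pairing k"
      unfolding im by (auto simp: pairing_def insert_commute)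
  qed
qed



text \<open>The regular character, 24 at the identity and 0 elsewhere, is the sum of the irreducible
  characters weighted by their dimensions 1, 1, 2, 3, 3. The proof inspects the 24
  permutations.\<close>

lemma irreducible_characters_id:
  assumes "g permutes {1..4}"
  shows "24 * of_bool (g = id) = 1 + of_int (sign g) + 2 * (\<Sum>i<2. standard_matrix 2 (pairing_action g) $$ (i, i)) +
    3 * (\<Sum>i<3. standard_matrix 3 g $$ (i, i)) + 3 * (of_int (sign g) * (\<Sum>i<3. standard_matrix 3 g $$ (i, i)))"
proof -
  \<comment> \<open>The closed form of \<open>pairing_action_simp\<close> with
    \<open>x = g k\<close> and \<open>y = g 4\<close>, so that the trace depends only on the four
    values of \<open>g\<close>.\<close>
  define pa where "pa x y = (if y = 4 then x else if x = 4 then y else 6 - x - y)" for x y :: nat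
  have 2: "(\<Sum>i<2. standard_matrix 2 (pairing_action g) $$ (i, i)) =
     of_bool (pa (g 1) (g 4) = 1) - of_bool (pa (g 3) (g 4) = 1) + (of_bool (pa (g 2) (g 4) = 2) - of_bool (pa (g 3) (g 4) = 2))"
    using pairing_action_simp[OF assms, of 1] pairing_action_simp[OF assms, of 2] pairing_action_simp[OF assms, of 3]
    by (simp add: standard_matrix_def pa_def numeral_2_eq_2 numeral_3_eq_3)
  have 3: "(\<Sum>i<3. standard_matrix 3 g $$ (i, i)) =
     of_bool (g 1 = 1) - of_bool (g 4 = 1) + (of_bool (g 2 = 2) - of_bool (g 4 = 2)) + (of_bool (g 3 = 3) - of_bool (g 4 = 3))"
    by (simp add: standard_matrix_def eval_nat_numeral)
  have id: "g = id \<longleftrightarrow> g 1 = 1 \<and> g 2 = 2 \<and> g 3 = 3 \<and> g 4 = 4"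
  proof
    assume *: "g 1 = 1 \<and> g 2 = 2 \<and> g 3 = 3 \<and> g 4 = 4"
    have "g x = x" for x
    proof (cases "x \<in> {1..4}")
      case True
      then have "x = 1 \<or> x = 2 \<or> x = 3 \<or> x = 4" by auto
      then show ?thesis using * by auto
    qed (use assms in \<open>auto simp: permutes_def\<close>)
    then show "g = id" by auto
  qed auto
  show ?thesis unfolding id 2 3 using permutes_4_values[OF assms]
    by (elim insertE emptyE Pair_inject) (simp_all only: pa_def, simp_all)
qed

lemma transposition_equivariant_id: "transposition_equivariant {1..4} (\<lambda>g. g)"
  by unfold_locales auto

text \<open>A transposition inside {1, 2, 3} fixes 4, so it sends the block {k, 4} to the block of
  the transposed label.\<close>

lemma pairing_action_transpose:
  assumes "b \<in> {1..3}" "c \<in> {1..3}"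
  shows "pairing_action (Transposition.transpose b c) = Transposition.transpose b c"
proof
  fix k
  have p: "Transposition.transpose b c permutes {1..4}" using assms by (intro permutes_swap_id) auto
  have 4: "Transposition.transpose b c 4 = 4" using assms by (auto simp: Transposition.transpose_def)
  show "pairing_action (Transposition.transpose b c) k = Transposition.transpose b c k"
  proof (cases "k \<in> {1..3}")
    case True
    then show ?thesis using pairing_action_simp[OF p True] 4 by simp
  next
    case False
    then show ?thesis using assms by (auto simp: pairing_action_def Transposition.transpose_def)
  qed
qed

lemma transposition_equivariant_pairing: "transposition_equivariant {1..3} pairing_action"
proof
  fix g :: "nat \<Rightarrow> nat" and b c :: nat
  assume g: "g permutes {1..4}" and bc: "b \<in> {1..3}" "c \<in> {1..3}"
  have "Transposition.transpose b c permutes {1..4}" using bc by (intro permutes_swap_id) auto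
  then show "pairing_action (Transposition.transpose b c \<circ> g) = Transposition.transpose b c \<circ> pairing_action g"
    using pairing_action_comp[of _ g] g bc by (simp add: pairing_action_transpose del: One_nat_def)
qed (auto intro: pairing_action_permutes simp del: One_nat_def)

lemma pairing_action_inv:
  assumes "g permutes {1..4}"
  shows "pairing_action (inv' g) = inv' (pairing_action g)"
  using pairing_action_comp[OF assms permutes_inv[OF assms]] pairing_action_id
  by (metis permutes_inv_o(1)[OF assms] pairing_action_comp[OF permutes_inv[OF assms] assms] permutes_inv_o(2)[OF assms] inv_unique_comp)

section \<open>The five irreducible representations\<close>

definition irreps :: "s4_rep list" where
  "irreps = [trivial_rep 1, sign_rep, two_dim_rep, standard_rep, tensor sign_rep standard_rep]"

lemma rep_dim_irreps [simp]:
  "rep_dim sign_rep = 1" "rep_dim two_dim_rep = 2" "rep_dim standard_rep = 3"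
  by (transfer; simp)+

lemma matrix_of_irreps [simp]:
  "matrix_of sign_rep g = mat 1 1 (\<lambda>_. of_int (sign g))"
  "matrix_of two_dim_rep g = standard_matrix 2 (pairing_action g)"
  "matrix_of standard_rep g = standard_matrix 3 g"
  by (transfer; simp)+

lemma standard_matrix_dim [simp]: "dim_row (standard_matrix n g) = n" "dim_col (standard_matrix n g) = n"
  by (simp_all add: standard_matrix_def)

text \<open>In dimension 1 the sum counts the group. The other cases are
  \<open>schur_orthogonality_standard\<close> for \<open>n = 2\<close> and \<open>n = 3\<close>; in
  the sign twist the signs of \<open>g\<close> and its inverse multiply to 1.\<close>

lemma schur_orthogonality:
  assumes "W \<in> set irreps" "i < rep_dim W" "j < rep_dim W" "k < rep_dim W" "l < rep_dim W"
  shows "of_nat (rep_dim W) * (\<Sum>g | g permutes {1..4}. matrix_of W (inv' g) $$ (i, j) * matrix_of W g $$ (k, l)) =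
    of_bool (i = l \<and> j = k) * 24"
proof -
  have card: "(\<Sum>g | g permutes {1..4::nat}. 1) = (24::complex)"
    by (simp add: card_permutations[OF refl] fact_numeral)
  have sgn: "of_int (sign (inv' g)) * of_int (sign g) = (1::complex)" if "g permutes {1..4}" for g :: "nat \<Rightarrow> nat"
    using that by (simp add: sign_inverse permutation_permutes flip: of_int_mult)
      (metis finite_atLeastAtMost of_int_1 of_int_mult permutation_permutes sign_idempotent sign_inverse)
  consider "W = trivial_rep 1" | "W = sign_rep" | "W = two_dim_rep" | "W = standard_rep" | "W = tensor sign_rep standard_rep"
    using assms(1) by (auto simp: irreps_def)
  then show ?thesis
  proof cases
    case 1
    then show ?thesis using assms card by simp
  next
    case 2
    then show ?thesis using assms card by (simp add: sgn del: One_nat_def)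
  next
    case 3
    have "(\<Sum>g | g permutes {1..4}. matrix_of W (inv' g) $$ (i, j) * matrix_of W g $$ (k, l)) =
      (\<Sum>g | g permutes {1..4}. standard_matrix 2 (inv' (pairing_action g)) $$ (i, j) * standard_matrix 2 (pairing_action g) $$ (k, l))"
      by (intro sum.cong) (auto simp: 3 pairing_action_inv simp del: One_nat_def)
    then show ?thesis
      using schur_orthogonality_standard[of 2 pairing_action i j k l] assms transposition_equivariant_pairing
      by (simp add: 3 numeral_3_eq_3[symmetric] del: One_nat_def) 
  next
    case 4
    then show ?thesis
      using schur_orthogonality_standard[of 3 "\<lambda>g. g" i j k l] assms transposition_equivariant_id
      by (simp del: One_nat_def) 
  next
    case 5
    have "(\<Sum>g | g permutes {1..4}. matrix_of W (inv' g) $$ (i, j) * matrix_of W g $$ (k, l)) =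
      (\<Sum>g | g permutes {1..4}. standard_matrix 3 (inv' g) $$ (i, j) * standard_matrix 3 g $$ (k, l))"
    proof (intro sum.cong refl)
      fix g :: "nat \<Rightarrow> nat" assume "g \<in> {g. g permutes {1..4}}"
      then show "matrix_of W (inv' g) $$ (i, j) * matrix_of W g $$ (k, l) = standard_matrix 3 (inv' g) $$ (i, j) * standard_matrix 3 g $$ (k, l)"
        using assms sgn[of g] by (simp add: 5 kronecker_index algebra_simps del: One_nat_def)
          
    qed
    then show ?thesis
      using schur_orthogonality_standard[of 3 "\<lambda>g. g" i j k l] assms transposition_equivariant_id
      by (simp add: 5 del: One_nat_def) 
  qed
qed

lemma sum_irreps_character:
  assumes "g permutes {1..4}"
  shows "(\<Sum>W\<leftarrow>irreps. of_nat (rep_dim W) * (\<Sum>i<rep_dim W. matrix_of W g $$ (i, i))) = 24 * of_bool (g = id)"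
  unfolding irreducible_characters_id[OF assms]
  by (simp add: irreps_def kronecker_index sum_distrib_left mult_ac)

section \<open>Splitting off irreducible representations\<close>

lemma index_mult_mat_sum:
  assumes "A \<in> carrier_mat n m" "B \<in> carrier_mat m p" "i < n" "j < p"
  shows "(A * B) $$ (i, j) = (\<Sum>c<m. A $$ (i, c) * B $$ (c, j))"
  using assms by (simp add: scalar_prod_def atLeast0LessThan)

lemma matrix_of_comp_index:
  assumes "g permutes {1..4}" "h permutes {1..4}" "i < rep_dim V" "j < rep_dim V"
  shows "matrix_of V (g \<circ> h) $$ (i, j) = (\<Sum>m<rep_dim V. matrix_of V g $$ (i, m) * matrix_of V h $$ (m, j))"
  using assms by (simp add: matrix_of_comp index_mult_mat_sum[OF matrix_of_carrier matrix_of_carrier])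

text \<open>Translation invariance of the sum over the group. The summand takes two arguments
  because the averages below contain the inverse of \<open>g\<close> next to the translated
  element.\<close>

lemma sum_permutes_comp_left:
  assumes "h permutes {1..4::nat}"
  shows "(\<Sum>g | g permutes {1..4}. f g (h \<circ> g)) = (\<Sum>g | g permutes {1..4}. f (inv' h \<circ> g) g)"
proof -
  have "(\<Sum>g | g permutes {1..4}. f (inv' h \<circ> g) g) = (\<Sum>g | g permutes {1..4}. f (inv' h \<circ> (h \<circ> g)) (h \<circ> g))"
    by (rule setum_permutations_compose_left[OF assms])
  then show ?thesis by (simp add: comp_assoc[symmetric] permutes_inv_o[OF assms])
qed

lemma sum_permutes_comp_right:
  assumes "h permutes {1..4::nat}"
  shows "(\<Sum>g | g permutes {1..4}. f g (g \<circ> h)) = (\<Sum>g | g permutes {1..4}. f (g \<circ> inv' h) g)"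
proof -
  have "(\<Sum>g | g permutes {1..4}. f (g \<circ> inv' h) g) = (\<Sum>g | g permutes {1..4}. f ((g \<circ> h) \<circ> inv' h) (g \<circ> h))"
    by (rule sum_permutations_compose_right[OF assms])
  then show ?thesis by (simp add: comp_assoc permutes_inv_o[OF assms])
qed

lemma inv_comp_inv:
  assumes "g permutes S" "h permutes S"
  shows "inv' (inv' h \<circ> g) = inv' g \<circ> h" "inv' (g \<circ> inv' h) = h \<circ> inv' g"
  using assms by (simp_all add: o_inv_distrib permutes_bij bij_imp_bij_inv inv_inv_eq)

lemma sum_list_map_neq_0: "(\<Sum>x\<leftarrow>xs. f x) \<noteq> 0 \<Longrightarrow> \<exists>x\<in>set xs. f x \<noteq> (0 :: 'a :: comm_monoid_add)"
  by (induction xs) auto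

lemma sum_list_sum_swap: "(\<Sum>g\<in>A. \<Sum>x\<leftarrow>xs. f x g) = (\<Sum>x\<leftarrow>xs. \<Sum>g\<in>A. f x g :: 'a :: comm_monoid_add)"
  by (induction xs) (auto simp: sum.distrib)

text \<open>\<open>T\<close> embeds \<open>D\<close> in \<open>V\<close>, and its left inverse
  \<open>S\<close> is equivariant too. Carrying \<open>S\<close> along makes \<open>T * S\<close> an
  equivariant projection, so an invariant complement of the image is always at hand.\<close>

definition embeds :: "s4_rep \<Rightarrow> s4_rep \<Rightarrow> complex mat \<Rightarrow> complex mat \<Rightarrow> bool" where
  "embeds D V S T \<longleftrightarrow>
     T \<in> carrier_mat (rep_dim V) (rep_dim D) \<and> S \<in> carrier_mat (rep_dim D) (rep_dim V) \<and>
     S * T = 1\<^sub>m (rep_dim D) \<and>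
     (\<forall>g. g permutes {1..4} \<longrightarrow> matrix_of V g * T = T * matrix_of D g \<and> S * matrix_of V g = matrix_of D g * S)"

text \<open>\<open>F\<close> projects onto an invariant subspace, and \<open>U g\<close> is the
  action of \<open>g\<close> there. Let E_ik be the sum over \<open>g\<close> of \<open>U g\<close>
  with weight \<open>d / 24 * matrix_of W (inv' g) $$ (i, k)\<close>, an averaged matrix unit. For a
  suitable fixed \<open>i\<close>, the columns \<open>b0\<close> of the E_ik form a copy of
  \<open>W\<close> in the image of \<open>F\<close>, and the rows \<open>a0\<close> of the E_ki give
  the map back.\<close>

lemma embeds_irrep:
  assumes F: "F \<in> carrier_mat (rep_dim V) (rep_dim V)" "F * F = F" "F \<noteq> 0\<^sub>m (rep_dim V) (rep_dim V)"
    and comm: "\<And>g. g permutes {1..4} \<Longrightarrow> matrix_of V g * F = F * matrix_of V g"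
  obtains W S T where "W \<in> set irreps" "embeds W V S T" "F * T = T" "S * F = S"
proof -
  define n where "n = rep_dim V"
  define U where "U g = matrix_of V g * F" for g
  note F = F[folded n_def]
  have Vc [simp]: "matrix_of V g \<in> carrier_mat n n" if "g permutes {1..4}" for g
    using that matrix_of_carrier n_def by simp
  have Uc [simp]: "U g \<in> carrier_mat n n" if "g permutes {1..4}" for g
    unfolding U_def by (rule mult_carrier_mat[OF Vc[OF that] F(1)])
  note assoc = assoc_mult_mat[of _ n n _ n _ n]
  have VU: "matrix_of V h * U g = U (h \<circ> g)" and UV: "U g * matrix_of V h = U (g \<circ> h)"
    and FU: "F * U g = U g" and UF: "U g * F = U g"
    if gh: "g permutes {1..4}" "h permutes {1..4}" for g h
  proof -
    show "matrix_of V h * U g = U (h \<circ> g)"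
      using F Vc gh by (simp add: U_def matrix_of_comp assoc)
    show UV: "U g * matrix_of V h = U (g \<circ> h)"
      using F(1) Vc[OF gh(1)] Vc[OF gh(2)] gh by (simp add: U_def matrix_of_comp assoc flip: comm)
    show UF: "U g * F = U g"
      using F Vc gh by (simp add: U_def assoc)
    have "F * U g = (F * matrix_of V g) * F"
      using F(1) Vc[OF gh(1)] by (simp add: U_def assoc)
    also have "\<dots> = U g * F" by (simp only: comm[OF gh(1)] U_def)
    finally show "F * U g = U g" using UF by simp
  qed
  obtain a0 b0 where ab: "a0 < n" "b0 < n" and nz: "F $$ (a0, b0) \<noteq> 0"
    using F(1,3) by (metis carrier_matD eq_matI index_zero_mat)
  have U_id: "U id = F" using F(1) by (simp add: U_def matrix_of_id n_def)
  \<comment> \<open>By the regular character the contributions of all \<open>W\<close> and all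
    diagonal indices \<open>i\<close> add up to 24 times the entry of \<open>F\<close>, so some
    contribution is nonzero when that entry is.\<close>
  have "(\<Sum>W\<leftarrow>irreps. \<Sum>i<rep_dim W. of_nat (rep_dim W) * (\<Sum>g | g permutes {1..4}. matrix_of W (inv' g) $$ (i, i) * U g $$ (a0, b0)))
    = (\<Sum>g | g permutes {1..4}. (\<Sum>W\<leftarrow>irreps. of_nat (rep_dim W) * (\<Sum>i<rep_dim W. matrix_of W (inv' g) $$ (i, i))) * U g $$ (a0, b0))"
    (is "?L = _")
    by (simp add: sum_list_sum_swap flip: sum_list_mult_const)
      (simp add: sum_distrib_left sum_distrib_right sum.swap[of _ _ "{..<_}"] ac_simps)
  also have "\<dots> = (\<Sum>g | g permutes {1..4}. if g = id then 24 * U g $$ (a0, b0) else 0)"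
  proof (intro sum.cong refl)
    fix g :: "nat \<Rightarrow> nat" assume "g \<in> {g. g permutes {1..4}}"
    then have g: "g permutes {1..4}" by simp
    have "inv' g = id \<longleftrightarrow> g = id" using g by (metis inv_id permutes_inv_inv)
    then show "(\<Sum>W\<leftarrow>irreps. of_nat (rep_dim W) * (\<Sum>i<rep_dim W. matrix_of W (inv' g) $$ (i, i))) * U g $$ (a0, b0) =
      (if g = id then 24 * U g $$ (a0, b0) else 0)"
      using sum_irreps_character[OF permutes_inv[OF g]] by simp
  qed
  also have "\<dots> = 24 * F $$ (a0, b0)"
    using U_id by (simp add: finite_permutations permutes_id)
  finally have "?L \<noteq> 0" using nz by simp
  then obtain W where W: "W \<in> set irreps"
    and "(\<Sum>i<rep_dim W. of_nat (rep_dim W) * (\<Sum>g | g permutes {1..4}. matrix_of W (inv' g) $$ (i, i) * U g $$ (a0, b0))) \<noteq> 0"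
    using sum_list_map_neq_0 by blast
  then obtain i where i: "i < rep_dim W"
    and z: "of_nat (rep_dim W) * (\<Sum>g | g permutes {1..4}. matrix_of W (inv' g) $$ (i, i) * U g $$ (a0, b0)) \<noteq> 0"
    by (meson lessThan_iff sum.neutral)
  define d where "d = rep_dim W"
  \<comment> \<open>\<open>z\<close> is the entry of E_ii at row \<open>a0\<close> and column
    \<open>b0\<close>. Dividing \<open>T\<close> by it makes the entry of \<open>T\<close> at
    \<open>a0\<close>, \<open>i\<close> equal to 1, which normalises \<open>S * T\<close>.\<close>
  define z where "z = of_nat d / 24 * (\<Sum>g | g permutes {1..4}. matrix_of W (inv' g) $$ (i, i) * U g $$ (a0, b0))"
  define T where "T = mat n d (\<lambda>(a, k). of_nat d / 24 / z * (\<Sum>g | g permutes {1..4}. matrix_of W (inv' g) $$ (i, k) * U g $$ (a, b0)))"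
  define S where "S = mat d n (\<lambda>(k, b). of_nat d / 24 * (\<Sum>g | g permutes {1..4}. matrix_of W (inv' g) $$ (k, i) * U g $$ (a0, b)))"
  have z0: "z \<noteq> 0" using z by (simp add: z_def d_def)
  note i = i[folded d_def]
  have Wc [simp]: "matrix_of W g \<in> carrier_mat d d" if "g permutes {1..4}" for g
    using that matrix_of_carrier d_def by simp
  have Tc: "T \<in> carrier_mat n d" and Sc: "S \<in> carrier_mat d n" by (simp_all add: T_def S_def)
  have XT: "(X * T) $$ (a, k) = of_nat d / 24 / z * (\<Sum>g | g permutes {1..4}. matrix_of W (inv' g) $$ (i, k) * (X * U g) $$ (a, b0))"
    if "X \<in> carrier_mat n n" "a < n" "k < d" for X a k
  proof -
    have "(X * T) $$ (a, k) = (\<Sum>c<n. X $$ (a, c) * (of_nat d / 24 / z * (\<Sum>g | g permutes {1..4}. matrix_of W (inv' g) $$ (i, k) * U g $$ (c, b0))))"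
      using that by (subst index_mult_mat_sum[OF that(1) Tc]) (auto simp: T_def)
    also have "\<dots> = of_nat d / 24 / z * (\<Sum>g | g permutes {1..4}. matrix_of W (inv' g) $$ (i, k) * (\<Sum>c<n. X $$ (a, c) * U g $$ (c, b0)))"
      unfolding sum_distrib_left by (subst sum.swap) (simp only: ac_simps)
    also have "\<dots> = of_nat d / 24 / z * (\<Sum>g | g permutes {1..4}. matrix_of W (inv' g) $$ (i, k) * (X * U g) $$ (a, b0))"
      using that ab by (intro arg_cong2[where f = "(*)"] sum.cong refl) (auto simp: index_mult_mat_sum[OF that(1) Uc])
    finally show ?thesis .
  qed
  \<comment> \<open>The number \<open>m\<close> of columns is left free because \<open>X\<close>
    will also be \<open>T\<close>.\<close>
  have SX: "(S * X) $$ (k, b) = of_nat d / 24 * (\<Sum>g | g permutes {1..4}. matrix_of W (inv' g) $$ (k, i) * (U g * X) $$ (a0, b))"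
    if "X \<in> carrier_mat n m" "b < m" "k < d" for X b k m
  proof -
    have "(S * X) $$ (k, b) = (\<Sum>c<n. of_nat d / 24 * (\<Sum>g | g permutes {1..4}. matrix_of W (inv' g) $$ (k, i) * U g $$ (a0, c)) * X $$ (c, b))"
      using that by (subst index_mult_mat_sum[OF Sc that(1)]) (auto simp: S_def)
    also have "\<dots> = of_nat d / 24 * (\<Sum>g | g permutes {1..4}. matrix_of W (inv' g) $$ (k, i) * (\<Sum>c<n. U g $$ (a0, c) * X $$ (c, b)))"
      unfolding sum_distrib_left sum_distrib_right by (subst sum.swap) (simp only: ac_simps)
    also have "\<dots> = of_nat d / 24 * (\<Sum>g | g permutes {1..4}. matrix_of W (inv' g) $$ (k, i) * (U g * X) $$ (a0, b))"
      using that ab by (intro arg_cong2[where f = "(*)"] sum.cong refl) (auto simp: index_mult_mat_sum[OF Uc that(1)])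
    finally show ?thesis .
  qed
  have T_comm: "matrix_of V h * T = T * matrix_of W h" if h: "h permutes {1..4}" for h
  proof (rule eq_matI)
    fix a k assume "a < dim_row (T * matrix_of W h)" "k < dim_col (T * matrix_of W h)"
    then have ak: "a < n" "k < d" using Tc Wc[OF h] by auto
    have "(matrix_of V h * T) $$ (a, k) = of_nat d / 24 / z * (\<Sum>g | g permutes {1..4}. matrix_of W (inv' g) $$ (i, k) * U (h \<circ> g) $$ (a, b0))"
      by (subst XT[OF Vc[OF h] ak], intro arg_cong2[where f = "(*)"] sum.cong refl) (simp add: VU h del: One_nat_def)
    also have "\<dots> = of_nat d / 24 / z * (\<Sum>g | g permutes {1..4}. matrix_of W (inv' (inv' h \<circ> g)) $$ (i, k) * U g $$ (a, b0))"
      by (subst sum_permutes_comp_left[OF h]) simp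
    also have "\<dots> = of_nat d / 24 / z * (\<Sum>g | g permutes {1..4}. (\<Sum>m<d. matrix_of W (inv' g) $$ (i, m) * matrix_of W h $$ (m, k)) * U g $$ (a, b0))"
      using i ak h by (intro arg_cong2[where f = "(*)"] sum.cong refl)
        (auto simp: inv_comp_inv[OF _ h] matrix_of_comp_index permutes_inv d_def)
    also have "\<dots> = (\<Sum>m<d. T $$ (a, m) * matrix_of W h $$ (m, k))"
      using ak unfolding sum_distrib_right sum_distrib_left 
      by (subst sum.swap) (simp add: T_def sum_distrib_left sum_distrib_right ac_simps)
    also have "\<dots> = (T * matrix_of W h) $$ (a, k)"
      using ak by (simp add: index_mult_mat_sum[OF Tc Wc[OF h]])
    finally show "(matrix_of V h * T) $$ (a, k) = (T * matrix_of W h) $$ (a, k)" .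
  qed (use Tc Wc[OF that] Vc[OF that] in auto)
  have S_comm: "S * matrix_of V h = matrix_of W h * S" if h: "h permutes {1..4}" for h
  proof (rule eq_matI)
    fix k b assume "k < dim_row (matrix_of W h * S)" "b < dim_col (matrix_of W h * S)"
    then have kb: "k < d" "b < n" using Sc Wc[OF h] by auto
    have "(S * matrix_of V h) $$ (k, b) = of_nat d / 24 * (\<Sum>g | g permutes {1..4}. matrix_of W (inv' g) $$ (k, i) * U (g \<circ> h) $$ (a0, b))"
      by (subst SX[OF Vc[OF h] kb(2,1)], intro arg_cong2[where f = "(*)"] sum.cong refl) (simp add: UV h del: One_nat_def)
    also have "\<dots> = of_nat d / 24 * (\<Sum>g | g permutes {1..4}. matrix_of W (inv' (g \<circ> inv' h)) $$ (k, i) * U g $$ (a0, b))"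
      by (subst sum_permutes_comp_right[OF h]) simp
    also have "\<dots> = of_nat d / 24 * (\<Sum>g | g permutes {1..4}. (\<Sum>m<d. matrix_of W h $$ (k, m) * matrix_of W (inv' g) $$ (m, i)) * U g $$ (a0, b))"
      using i kb h by (intro arg_cong2[where f = "(*)"] sum.cong refl)
        (auto simp: inv_comp_inv[OF _ h] matrix_of_comp_index permutes_inv d_def)
    also have "\<dots> = (\<Sum>m<d. matrix_of W h $$ (k, m) * S $$ (m, b))"
      using kb unfolding sum_distrib_right sum_distrib_left
      by (subst sum.swap) (simp add: S_def sum_distrib_left sum_distrib_right ac_simps)
    also have "\<dots> = (matrix_of W h * S) $$ (k, b)"
      using kb by (simp add: index_mult_mat_sum[OF Wc[OF h] Sc])
    finally show "(S * matrix_of V h) $$ (k, b) = (matrix_of W h * S) $$ (k, b)" .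
  qed (use Sc Wc[OF that] Vc[OF that] in auto)
  have FT: "F * T = T"
  proof (rule eq_matI)
    fix a k assume "a < dim_row T" "k < dim_col T"
    then have ak: "a < n" "k < d" using Tc by auto
    show "(F * T) $$ (a, k) = T $$ (a, k)"
      using ak by (subst XT[OF F(1) ak]) (simp add: T_def FU[OF _ permutes_id])
  qed (use F(1) Tc in auto)
  have ST: "S * T = 1\<^sub>m d"
  proof (rule eq_matI)
    fix k l assume "k < dim_row (1\<^sub>m d :: complex mat)" "l < dim_col (1\<^sub>m d :: complex mat)"
    then have kl: "k < d" "l < d" by auto
    have UT: "(U g * T) $$ (a0, l) = (\<Sum>m<d. T $$ (a0, m) * matrix_of W g $$ (m, l))" if g: "g permutes {1..4}" for g
    proof -
      have "U g * T = T * matrix_of W g"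
        using Vc[OF g] F Tc FT by (simp add: U_def T_comm[OF g] assoc_mult_mat[of _ n n _ n _ d])
      then show ?thesis using ab kl by (simp add: index_mult_mat_sum[OF Tc Wc[OF g]])
    qed
    have "(S * T) $$ (k, l) = of_nat d / 24 * (\<Sum>g | g permutes {1..4}. matrix_of W (inv' g) $$ (k, i) * (\<Sum>m<d. T $$ (a0, m) * matrix_of W g $$ (m, l)))"
      by (subst SX[OF Tc kl(2,1)]) (simp add: UT)
    also have "\<dots> = (\<Sum>m<d. T $$ (a0, m) * (of_nat d * (\<Sum>g | g permutes {1..4}. matrix_of W (inv' g) $$ (k, i) * matrix_of W g $$ (m, l)) / 24))"
      unfolding sum_distrib_left sum_divide_distrib by (subst sum.swap) (simp add: ac_simps)
    also have "\<dots> = (\<Sum>m<d. if m = i then T $$ (a0, m) * of_bool (k = l) else 0)"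
      using schur_orthogonality[OF W, folded d_def] kl i by (intro sum.cong) auto
    also have "\<dots> = T $$ (a0, i) * of_bool (k = l)" using i by simp
    also have "T $$ (a0, i) = 1" using ab i z0 by (simp add: T_def) (simp add: z_def)
    finally show "(S * T) $$ (k, l) = 1\<^sub>m d $$ (k, l)" using kl by simp
  qed (use Sc Tc in auto)
  have SF: "S * F = S"
  proof (rule eq_matI)
    fix k b assume "k < dim_row S" "b < dim_col S"
    then have kb: "k < d" "b < n" using Sc by auto
    show "(S * F) $$ (k, b) = S $$ (k, b)"
      using kb by (subst SX[OF F(1) kb(2,1)]) (simp add: S_def UF[OF _ permutes_id])
  qed (use F(1) Sc in auto)
  have "embeds W V S T"
    unfolding embeds_def using Tc Sc ST T_comm S_comm by (simp add: n_def d_def)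
  then show thesis using that W FT SF by blast
qed

text \<open>If \<open>n < u\<close>, padding \<open>S\<close> and \<open>T\<close> with zeros to
  square matrices keeps the product equal to 1, so the product in the other order is 1 as well. But
  row \<open>n\<close> of the padded \<open>T\<close> is zero.\<close>

lemma left_inverse_dim_le:
  fixes S T :: "complex mat"
  assumes S: "S \<in> carrier_mat u n" and T: "T \<in> carrier_mat n u" and ST: "S * T = 1\<^sub>m u"
  shows "u \<le> n"
proof (rule ccontr)
  assume "\<not> u \<le> n"
  then have n: "n < u" by simp
  define S' where "S' = mat u u (\<lambda>(i, j). if j < n then S $$ (i, j) else 0)"
  define T' where "T' = mat u u (\<lambda>(i, j). if i < n then T $$ (i, j) else 0)"
  have c: "S' \<in> carrier_mat u u" "T' \<in> carrier_mat u u" by (simp_all add: S'_def T'_def)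
  have "S' * T' = 1\<^sub>m u"
  proof (rule eq_matI)
    fix i j assume "i < dim_row (1\<^sub>m u :: complex mat)" "j < dim_col (1\<^sub>m u :: complex mat)"
    then have ij: "i < u" "j < u" by auto
    have "(S' * T') $$ (i, j) = (\<Sum>c<u. if c < n then S $$ (i, c) * T $$ (c, j) else 0)"
      using ij by (subst index_mult_mat_sum[OF c ij]) (auto simp: S'_def T'_def intro!: sum.cong)
    also have "\<dots> = (\<Sum>c<n. S $$ (i, c) * T $$ (c, j))"
      using n by (intro sum.mono_neutral_cong_right) auto
    also have "\<dots> = (S * T) $$ (i, j)" by (simp add: index_mult_mat_sum[OF S T ij])
    finally show "(S' * T') $$ (i, j) = 1\<^sub>m u $$ (i, j)" by (simp add: ST)
  qed (use c in auto)
  then have "T' * S' = 1\<^sub>m u" by (rule mat_mult_left_right_inverse[OF c])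
  then have "(T' * S') $$ (n, n) = 1" using n by simp
  moreover have "(T' * S') $$ (n, n) = 0"
    using n by (subst index_mult_mat_sum[OF c(2,1)]) (auto simp: T'_def)
  ultimately show False by simp
qed

lemma embeds_direct_sum:
  assumes D: "embeds D V S T" and W: "embeds W V S' T'" and orth: "S * T' = 0\<^sub>m (rep_dim D) (rep_dim W)" "S' * T = 0\<^sub>m (rep_dim W) (rep_dim D)"
  shows "\<exists>S T. embeds (direct_sum D W) V S T"
proof -
  define n u d where "n = rep_dim V" and "u = rep_dim D" and "d = rep_dim W"
  note defs = n_def[symmetric] u_def[symmetric] d_def[symmetric]
  have T: "T \<in> carrier_mat n u" "T' \<in> carrier_mat n d" and S: "S \<in> carrier_mat u n" "S' \<in> carrier_mat d n"
    and ST: "S * T = 1\<^sub>m u" "S' * T' = 1\<^sub>m d"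
    using D W by (auto simp: embeds_def defs)
  \<comment> \<open>Blocks with no rows, and below with no columns, turn a row or column of two
    blocks into a four-block matrix, to which the block multiplication rule applies.\<close>
  define T2 where "T2 = four_block_mat T T' (0\<^sub>m 0 u) (0\<^sub>m 0 d)"
  define S2 where "S2 = four_block_mat S (0\<^sub>m u 0) S' (0\<^sub>m d 0)"
  have T2: "T2 \<in> carrier_mat n (u + d)" using T four_block_carrier_mat[OF T(1), of "0\<^sub>m 0 d" 0 d] by (simp add: T2_def)
  have S2: "S2 \<in> carrier_mat (u + d) n" using S four_block_carrier_mat[OF S(1), of "0\<^sub>m d 0" d 0] by (simp add: S2_def)
  have V4: "A = four_block_mat A (0\<^sub>m n 0) (0\<^sub>m 0 n) (0\<^sub>m 0 0)" if "A \<in> carrier_mat n n" for A :: "complex mat"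
    using that by (intro eq_matI) auto
  have "S2 * T2 = four_block_mat (S * T) (S * T') (S' * T) (S' * T')"
    unfolding S2_def T2_def using S T
    by (subst mult_four_block_mat[of _ u n _ 0 _ d _ _ u _ d]) auto
  also have "\<dots> = 1\<^sub>m (u + d)" by (simp add: ST orth defs)
  finally have "S2 * T2 = 1\<^sub>m (u + d)" .
  moreover have "matrix_of V g * T2 = T2 * matrix_of (direct_sum D W) g" "S2 * matrix_of V g = matrix_of (direct_sum D W) g * S2"
    if g: "g permutes {1..4}" for g
  proof -
    have c: "matrix_of V g \<in> carrier_mat n n" "matrix_of D g \<in> carrier_mat u u" "matrix_of W g \<in> carrier_mat d d"
      using matrix_of_carrier[OF g] by (simp_all add: n_def u_def d_def)
    have comm: "matrix_of V g * T = T * matrix_of D g" "S * matrix_of V g = matrix_of D g * S"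
       "matrix_of V g * T' = T' * matrix_of W g" "S' * matrix_of V g = matrix_of W g * S'"
      using D W g by (auto simp: embeds_def)
    have blk: "matrix_of (direct_sum D W) g = four_block_mat (matrix_of D g) (0\<^sub>m u d) (0\<^sub>m d u) (matrix_of W g)"
      using c by (auto simp: block_sum_def)
    have "matrix_of V g * T2 = four_block_mat (matrix_of V g * T) (matrix_of V g * T') (0\<^sub>m 0 u) (0\<^sub>m 0 d)"
      unfolding T2_def using T c
      by (subst V4[OF c(1)], subst mult_four_block_mat[of _ n n _ 0 _ 0 _ _ u _ d]) auto
    also have "\<dots> = T2 * matrix_of (direct_sum D W) g"
      unfolding T2_def blk comm using T c
      by (subst mult_four_block_mat[of _ n u _ d _ 0 _ _ u _ d]) auto
    finally show "matrix_of V g * T2 = T2 * matrix_of (direct_sum D W) g" .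
    have "S2 * matrix_of V g = four_block_mat (S * matrix_of V g) (0\<^sub>m u 0) (S' * matrix_of V g) (0\<^sub>m d 0)"
      unfolding S2_def using S c
      by (subst V4[OF c(1)], subst mult_four_block_mat[of _ u n _ 0 _ d _ _ n _ 0]) auto
    also have "\<dots> = matrix_of (direct_sum D W) g * S2"
      unfolding S2_def blk comm using S c
      by (subst mult_four_block_mat[of _ u u _ d _ d _ _ n _ 0]) auto
    finally show "S2 * matrix_of V g = matrix_of (direct_sum D W) g * S2" .
  qed
  ultimately have "embeds (direct_sum D W) V S2 T2"
    using S2 T2 by (simp add: embeds_def defs)
  then show ?thesis by blast
qed

inductive_set decomposable :: "rep_class set" where
  zero: "0 \<in> decomposable"
| add: "x \<in> decomposable \<Longrightarrow> W \<in> set irreps \<Longrightarrow> x + abs_rep_class W \<in> decomposable"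

text \<open>\<open>F = 1 - T * S\<close> projects onto the complement of a largest decomposable
  summand. An irreducible split off there satisfies \<open>F * T' = T'\<close> and
  \<open>S' * F = S'\<close>; with \<open>S * F = 0\<close> and \<open>F * T = 0\<close> this yields
  both orthogonality relations of \<open>embeds_direct_sum\<close>. The enlarged summand contradicts
  maximality, as every irreducible has positive dimension.\<close>

lemma abs_rep_class_decomposable: "abs_rep_class V \<in> decomposable"
proof -
  define n where "n = rep_dim V"
  define P where "P u \<longleftrightarrow> (\<exists>D S T. embeds D V S T \<and> abs_rep_class D \<in> decomposable \<and> rep_dim D = u)" for u
  have le: "u \<le> n" if "P u" for u
    using that left_inverse_dim_le unfolding P_def embeds_def n_def by blast
  have "embeds (trivial_rep 0) V (0\<^sub>m 0 n) (0\<^sub>m n 0)"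
    by (auto simp: embeds_def n_def matrix_of_dim simp del: One_nat_def intro!: eq_matI)
  moreover have "abs_rep_class (trivial_rep 0) = 0" by (simp add: zero_rep_class_def)
  ultimately have "P 0" unfolding P_def using decomposable.zero
    by (intro exI[of _ "trivial_rep 0"] exI[of _ "0\<^sub>m 0 n"] exI[of _ "0\<^sub>m n 0"]) simp
  then obtain u where "P u" and max: "\<And>u'. P u' \<Longrightarrow> u' \<le> u"
    using le GreatestI_nat[of P 0 n] Greatest_le_nat[of P _ n] by metis
  then obtain D S T where D: "embeds D V S T" "abs_rep_class D \<in> decomposable" "rep_dim D = u"
    unfolding P_def by blast
  have T: "T \<in> carrier_mat n u" and S: "S \<in> carrier_mat u n" and ST: "S * T = 1\<^sub>m u"
    using D by (auto simp: embeds_def n_def)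
  note comm = D(1)[unfolded embeds_def, THEN conjunct2, THEN conjunct2, THEN conjunct2, rule_format]
  define F where "F = 1\<^sub>m n - T * S"
  have TS: "T * S \<in> carrier_mat n n" using T S by simp
  have F: "F \<in> carrier_mat n n" using TS by (simp add: F_def minus_carrier_mat)
  have SF: "S * F = 0\<^sub>m u n"
  proof -
    have "S * F = S * 1\<^sub>m n - S * (T * S)" unfolding F_def by (rule mult_minus_distrib_mat[OF S _ TS]) simp
    also have "S * (T * S) = (S * T) * S" using S T by simp
    finally show ?thesis using S by (simp add: ST)
  qed
  have FT: "F * T = 0\<^sub>m n u"
  proof -
    have "F * T = 1\<^sub>m n * T - (T * S) * T" unfolding F_def by (rule minus_mult_distrib_mat[OF _ TS T]) simp
    also have "(T * S) * T = T * (S * T)" using S T by (simp add: assoc_mult_mat[of _ n u _ n _ u])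
    finally show ?thesis using T by (simp add: ST)
  qed
  have FF: "F * F = F"
  proof -
    have "F * F = F * (1\<^sub>m n - T * S)" by (simp add: F_def)
    also have "\<dots> = F * 1\<^sub>m n - F * (T * S)" by (rule mult_minus_distrib_mat[OF F _ TS]) simp
    also have "F * (T * S) = (F * T) * S" using F S T by simp
    finally have "F * F = F - 0\<^sub>m n n" using F S by (simp add: FT)
    also have "\<dots> = F" using F by (intro eq_matI) auto
    finally show ?thesis .
  qed
  have Fcomm: "matrix_of V g * F = F * matrix_of V g" if g: "g permutes {1..4}" for g
  proof -
    have c: "matrix_of V g \<in> carrier_mat n n" "matrix_of D g \<in> carrier_mat u u"
      using matrix_of_carrier[OF g] D(3) by (auto simp: n_def)
    have "matrix_of V g * (T * S) = (matrix_of V g * T) * S" using c S T by simp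
    also have "\<dots> = T * (matrix_of D g * S)" using comm[OF g] c S T by simp
    also have "\<dots> = (T * S) * matrix_of V g" using comm[OF g] c S T by (simp add: assoc_mult_mat[of _ n u _ n _ n])
    finally show ?thesis
      unfolding F_def using mult_minus_distrib_mat[OF c(1) _ TS, of "1\<^sub>m n"] minus_mult_distrib_mat[OF _ TS c(1), of "1\<^sub>m n"] c
      by simp
  qed
  have "F = 0\<^sub>m n n"
  proof (rule ccontr)
    assume "F \<noteq> 0\<^sub>m n n"
    then obtain W S' T' where W: "W \<in> set irreps" "embeds W V S' T'" "F * T' = T'" "S' * F = S'"
      using embeds_irrep[of F V] F FF Fcomm unfolding n_def by metis
    define d where "d = rep_dim W"
    have T': "T' \<in> carrier_mat n d" and S': "S' \<in> carrier_mat d n" using W(2) by (auto simp: embeds_def n_def d_def)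
    have "S * T' = (S * F) * T'" using W(3) S F T' by (simp add: assoc_mult_mat[of _ u n _ n _ d])
    then have 1: "S * T' = 0\<^sub>m u d" using SF T' by simp
    have "S' * T = S' * (F * T)" using W(4) assoc_mult_mat[OF S' F T] by simp
    then have 2: "S' * T = 0\<^sub>m d u" using FT S' by simp
    obtain S2 T2 where "embeds (direct_sum D W) V S2 T2"
      using embeds_direct_sum[OF D(1) W(2)] 1 2 D(3) d_def by auto
    moreover have "abs_rep_class (direct_sum D W) \<in> decomposable"
      using decomposable.add[OF D(2) W(1)] by (simp add: plus_rep_class.abs_eq)
    ultimately have "P (u + d)" unfolding P_def using D(3) d_def by (metis rep_dim_simps(2))
    then have "d = 0" using max by fastforce
    then show False using W(1) by (auto simp: d_def irreps_def)
  qed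
  then have "1\<^sub>m n - (T * S) + T * S = 0\<^sub>m n n + T * S" by (simp add: F_def)
  moreover have "A - M + M = A" if "A \<in> carrier_mat n n" "M \<in> carrier_mat n n" for A M :: "complex mat"
    using that by (intro eq_matI) auto
  then have "1\<^sub>m n - (T * S) + T * S = 1\<^sub>m n" using TS by simp
  ultimately have TS1: "T * S = 1\<^sub>m n" using TS by simp
  then have "n \<le> u" using left_inverse_dim_le[OF T S] by simp
  moreover have "u \<le> n" using left_inverse_dim_le[OF S T] ST by simp
  ultimately have un: "u = n" by simp
  have "isomorphic_rep D V"
    using D T S TS1 ST comm un
    by (intro isomorphic_repI[of D n V T S]) (auto simp: n_def)
  then have "abs_rep_class D = abs_rep_class V" by (simp add: rep_class.abs_eq_iff)
  then show ?thesis using D by simp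
qed

section \<open>Characters and the multiplication table\<close>

definition rep_char :: "s4_rep \<Rightarrow> (nat \<Rightarrow> nat) \<Rightarrow> complex" where
  "rep_char V g = (\<Sum>i<rep_dim V. matrix_of V g $$ (i, i))"

text \<open>Cyclic invariance of the trace: tr(V g) = tr(T' T V g) = tr(T' W g T) = tr(W g T T') =
  tr(W g).\<close>

lemma rep_char_cong:
  assumes "isomorphic_rep V W" and g: "g permutes {1..4}"
  shows "rep_char V g = rep_char W g"
  using assms(1)
proof (rule isomorphic_repE)
  fix T T'
  define n where "n = rep_dim W"
  assume T: "T \<in> carrier_mat (rep_dim W) (rep_dim W)" "T' \<in> carrier_mat (rep_dim W) (rep_dim W)"
    and dim: "rep_dim V = rep_dim W" and inv: "T * T' = 1\<^sub>m (rep_dim W)" "T' * T = 1\<^sub>m (rep_dim W)"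
    and comm: "\<And>g. g permutes {1..4} \<Longrightarrow> T * matrix_of V g = matrix_of W g * T"
  note T = T[folded n_def] and inv = inv[folded n_def]
  have c: "matrix_of V g \<in> carrier_mat n n" "matrix_of W g \<in> carrier_mat n n"
    using matrix_of_carrier[OF g] dim n_def by metis+
  have "rep_char V g = (\<Sum>i<n. (T' * (T * matrix_of V g)) $$ (i, i))"
    using assoc_mult_mat[OF T(2,1) c(1)] inv c by (simp add: rep_char_def dim n_def)
  also have "\<dots> = (\<Sum>i<n. \<Sum>j<n. T' $$ (i, j) * (matrix_of W g * T) $$ (j, i))"
    using T c comm[OF g] by (simp add: index_mult_mat_sum[OF T(2), of "matrix_of W g * T" n] del: index_mult_mat)
  also have "\<dots> = (\<Sum>j<n. \<Sum>i<n. (matrix_of W g * T) $$ (j, i) * T' $$ (i, j))"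
    by (subst sum.swap) (simp add: ac_simps)
  also have "\<dots> = (\<Sum>j<n. (matrix_of W g * T * T') $$ (j, j))"
    by (intro sum.cong refl) (simp only: lessThan_iff index_mult_mat_sum[OF mult_carrier_mat[OF c(2) T(1)] T(2)])
  also have "\<dots> = rep_char W g"
    using assoc_mult_mat[OF c(2) T] inv c by (simp add: rep_char_def n_def)
  finally show ?thesis .
qed

lemma sum_lessThan_add:
  fixes a b :: nat
  shows "(\<Sum>k<a + b. f k) = (\<Sum>k<a. f k) + (\<Sum>k<b. f (a + k) :: 'a :: comm_monoid_add)"
  by (induction b) (auto simp: ac_simps)

lemma rep_char_direct_sum:
  assumes "g permutes {1..4}"
  shows "rep_char (direct_sum V W) g = rep_char V g + rep_char W g"
  unfolding rep_char_def rep_dim_simps sum_lessThan_add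
  by (simp add: block_sum_index matrix_of_dim[OF assms])

lemma rep_char_tensor:
  assumes "g permutes {1..4}"
  shows "rep_char (tensor V W) g = rep_char V g * rep_char W g"
proof -
  have "rep_char (tensor V W) g = (\<Sum>k<rep_dim V * rep_dim W. matrix_of V g $$ (k div rep_dim W, k div rep_dim W) *
      matrix_of W g $$ (k mod rep_dim W, k mod rep_dim W))"
    unfolding rep_char_def by (auto simp: kronecker_index matrix_of_dim[OF assms] intro!: sum.cong)
  also have "\<dots> = (\<Sum>i<rep_dim V. \<Sum>j<rep_dim W. matrix_of V g $$ (i, i) * matrix_of W g $$ (j, j))"
    by (rule sum_div_mod)
  finally show ?thesis by (simp add: rep_char_def sum_product)
qed

text \<open>Isomorphism constrains the matrices only at permutations of {1..4}; the value 0
  elsewhere makes the function well defined on classes.\<close>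

lift_definition class_char :: "rep_class \<Rightarrow> (nat \<Rightarrow> nat) \<Rightarrow> complex" is
  "\<lambda>V g. if g permutes {1..4} then rep_char V g else 0"
  using rep_char_cong by fastforce

lemma class_char_simps:
  assumes "g permutes {1..4}"
  shows "class_char 0 g = 0" "class_char 1 g = 1" "class_char (x + y) g = class_char x g + class_char y g"
    "class_char (x * y) g = class_char x g * class_char y g" "class_char (of_nat n) g = of_nat n"
    "class_char (abs_rep_class V) g = rep_char V g"
proof -
  show 0: "class_char 0 g = 0" "class_char 1 g = 1"
    using assms by (transfer; simp add: rep_char_def)+
  show add: "class_char (x + y) g = class_char x g + class_char y g" for x y
    using assms by transfer (simp add: rep_char_direct_sum del: One_nat_def)
  show "class_char (x * y) g = class_char x g * class_char y g" 
    using assms by transfer (simp add: rep_char_tensor del: One_nat_def)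
  show "class_char (of_nat n) g = of_nat n"
    by (induction n) (simp_all add: 0 add)
  show "class_char (abs_rep_class V) g = rep_char V g"
    using assms by (simp add: class_char.abs_eq)
qed

section \<open>Characters determine isomorphism classes\<close>

definition irrep_combination :: "nat \<Rightarrow> nat \<Rightarrow> nat \<Rightarrow> nat \<Rightarrow> nat \<Rightarrow> rep_class" where
  "irrep_combination a b c d e = of_nat a + of_nat b * abs_rep_class sign_rep + of_nat c * abs_rep_class two_dim_rep +
    of_nat d * abs_rep_class standard_rep + of_nat e * (abs_rep_class sign_rep * abs_rep_class standard_rep)"

lemma irrep_combinationE:
  obtains a b c d e where "x = irrep_combination a b c d e"
proof -
  have "\<exists>a b c d e. x = irrep_combination a b c d e" if "x \<in> decomposable" for x
    using that
  proof induction
    case zero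
    show ?case by (intro exI[of _ 0]) (simp add: irrep_combination_def)
  next
    case (add x W)
    then obtain a b c d e where x: "x = irrep_combination a b c d e" by blast
    have one: "abs_rep_class (trivial_rep 1) = 1" by (simp add: one_rep_class_def)
    from add(2) consider "W = trivial_rep 1" | "W = sign_rep" | "W = two_dim_rep" | "W = standard_rep" | "W = tensor sign_rep standard_rep"
      by (auto simp: irreps_def)
    then show ?case
    proof cases
      case 1
      then have "x + abs_rep_class W = irrep_combination (Suc a) b c d e"
        by (simp add: x one irrep_combination_def algebra_simps del: One_nat_def)
      then show ?thesis by blast
    next
      case 2
      then have "x + abs_rep_class W = irrep_combination a (Suc b) c d e"
        by (simp add: x irrep_combination_def algebra_simps)
      then show ?thesis by blast
    next
      case 3
      then have "x + abs_rep_class W = irrep_combination a b (Suc c) d e"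
        by (simp add: x irrep_combination_def algebra_simps)
      then show ?thesis by blast
    next
      case 4
      then have "x + abs_rep_class W = irrep_combination a b c (Suc d) e"
        by (simp add: x irrep_combination_def algebra_simps)
      then show ?thesis by blast
    next
      case 5
      then have "x + abs_rep_class W = irrep_combination a b c d (Suc e)"
        by (simp add: x irrep_combination_def algebra_simps times_rep_class.abs_eq)
      then show ?thesis by blast
    qed
  qed
  moreover have "x \<in> decomposable"
    by (induction x rule: rep_class.abs_induct) (rule abs_rep_class_decomposable)
  ultimately show thesis using that by blast
qed

text \<open>One element of each conjugacy class: identity, transposition, double transposition,
  3-cycle, 4-cycle.\<close>

definition class_reps :: "(nat \<Rightarrow> nat) list" where
  "class_reps = [id, Transposition.transpose 1 2, Transposition.transpose 1 2 \<circ> Transposition.transpose 3 4,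
    Transposition.transpose 1 2 \<circ> Transposition.transpose 2 3,
    Transposition.transpose 1 2 \<circ> (Transposition.transpose 2 3 \<circ> Transposition.transpose 3 4)]"

lemma class_reps_permutes: "g \<in> set class_reps \<Longrightarrow> g permutes {1..4}"
  by (auto simp: class_reps_def simp del: One_nat_def intro!: permutes_compose permutes_swap_id permutes_id)

lemma rep_char_table:
  "map (rep_char sign_rep) class_reps = [1, -1, 1, 1, -1]"
  "map (rep_char two_dim_rep) class_reps = [2, 0, 2, -1, 0]"
  "map (rep_char standard_rep) class_reps = [3, 1, -1, 0, -1]"
proof -
  have "\<forall>g\<in>set class_reps. rep_char sign_rep g = of_int (sign g)" by (simp add: rep_char_def)
  then show "map (rep_char sign_rep) class_reps = [1, -1, 1, 1, -1]"
    by (simp add: class_reps_def sign_compose permutation_compose permutation_swap_id sign_swap_id)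
  define pa where "pa x y = (if y = 4 then x else if x = 4 then y else 6 - x - y)" for x y :: nat
  have 2: "rep_char two_dim_rep g =
     of_bool (pa (g 1) (g 4) = 1) - of_bool (pa (g 3) (g 4) = 1) + (of_bool (pa (g 2) (g 4) = 2) - of_bool (pa (g 3) (g 4) = 2))"
    if "g \<in> set class_reps" for g
    using pairing_action_simp[OF class_reps_permutes[OF that], of 1] pairing_action_simp[OF class_reps_permutes[OF that], of 2]
      pairing_action_simp[OF class_reps_permutes[OF that], of 3]
    by (simp add: rep_char_def standard_matrix_def pa_def numeral_2_eq_2 numeral_3_eq_3)
  have "map (rep_char two_dim_rep) class_reps = map (\<lambda>g. of_bool (pa (g 1) (g 4) = 1) - of_bool (pa (g 3) (g 4) = 1) + (of_bool (pa (g 2) (g 4) = 2) - of_bool (pa (g 3) (g 4) = 2))) class_reps"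
    using 2 by (intro map_cong refl)
  then show "map (rep_char two_dim_rep) class_reps = [2, 0, 2, -1, 0]"
    by (simp add: class_reps_def pa_def Transposition.transpose_def)
  have "rep_char standard_rep g =
     of_bool (g 1 = 1) - of_bool (g 4 = 1) + (of_bool (g 2 = 2) - of_bool (g 4 = 2)) + (of_bool (g 3 = 3) - of_bool (g 4 = 3))" for g
    by (simp add: rep_char_def standard_matrix_def eval_nat_numeral)
  then show "map (rep_char standard_rep) class_reps = [3, 1, -1, 0, -1]"
    by (simp add: class_reps_def Transposition.transpose_def)
qed

lemma class_eqI:
  assumes "map (class_char x) class_reps = map (class_char y) class_reps"
  shows "x = y"
proof -
  obtain a b c d e where x: "x = irrep_combination a b c d e" by (rule irrep_combinationE)
  obtain a' b' c' d' e' where y: "y = irrep_combination a' b' c' d' e'" by (rule irrep_combinationE)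
  have chr: "class_char (irrep_combination a b c d e) g = of_nat a + of_nat b * rep_char sign_rep g +
    of_nat c * rep_char two_dim_rep g + of_nat d * rep_char standard_rep g + of_nat e * (rep_char sign_rep g * rep_char standard_rep g)"
    if "g \<in> set class_reps" for g a b c d e
    using class_reps_permutes[OF that] by (simp add: irrep_combination_def class_char_simps del: One_nat_def)
  have eq: "of_nat a + of_nat b * s + of_nat c * t + of_nat d * u + of_nat e * (s * u) =
     of_nat a' + of_nat b' * s + of_nat c' * t + of_nat d' * u + of_nat e' * (s * (u :: complex))"
    if "(s, t, u) \<in> {(1, 2, 3), (-1, 0, 1), (1, 2, -1), (1, -1, 0), (-1, 0, -1)}" for s t u
  proof -
    \<comment> \<open>The five triples are the columns of the character table, so each belongs to
      some \<open>g\<close> in \<open>class_reps\<close>.\<close>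
    have "(s, t, u) \<in> set (zip (map (rep_char sign_rep) class_reps) (zip (map (rep_char two_dim_rep) class_reps) (map (rep_char standard_rep) class_reps)))"
      using that unfolding rep_char_table by simp
    then obtain g where g: "g \<in> set class_reps" "s = rep_char sign_rep g" "t = rep_char two_dim_rep g" "u = rep_char standard_rep g"
      by (auto simp: zip_map_map zip_same_conv_map class_reps_def)
    have "class_char x g = class_char y g" using assms g(1) by simp
    then show ?thesis unfolding x y chr[OF g(1)] g(2-4) .
  qed
  \<comment> \<open>Five linear equations whose matrix is the invertible character table. Real parts
    bring them into an ordered field, where linear arithmetic applies.\<close>
  have "a = a' \<and> b = b' \<and> c = c' \<and> d = d' \<and> e = e'"
    using eq[of 1 2 3, THEN arg_cong[where f = Re]] eq[of "-1" 0 1, THEN arg_cong[where f = Re]] eq[of 1 2 "-1", THEN arg_cong[where f = Re]]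
      eq[of 1 "-1" 0, THEN arg_cong[where f = Re]] eq[of "-1" 0 "-1", THEN arg_cong[where f = Re]]
    by simp
  then show ?thesis by (simp add: x y)
qed

section \<open>Relations and generators of the Grothendieck ring\<close>

definition class_in_ring :: "rep_class \<Rightarrow> rep_ring" where
  "class_in_ring x = abs_rep_ring (x, 0)"

lemma class_in_ring_simps:
  "class_in_ring 0 = 0" "class_in_ring 1 = 1" "class_in_ring (x + y) = class_in_ring x + class_in_ring y"
  "class_in_ring (x * y) = class_in_ring x * class_in_ring y"
  by (simp_all add: class_in_ring_def zero_rep_ring_def one_rep_ring_def plus_rep_ring.abs_eq times_rep_ring.abs_eq)

lemma class_in_ring_of_nat: "class_in_ring (of_nat n) = of_nat n"
  by (induction n) (simp_all add: class_in_ring_simps)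

lemma V_class:
  "V_psi = class_in_ring (abs_rep_class sign_rep)" "V_rho1 = class_in_ring (abs_rep_class two_dim_rep)"
  "V_rho2 = class_in_ring (abs_rep_class standard_rep)"
  by (simp_all add: V_psi_def V_rho1_def V_rho2_def rep_ring_of_def class_in_ring_def)

text \<open>Each identity already holds between isomorphism classes, where \<open>class_eqI\<close>
  reduces it to numbers; \<open>class_in_ring\<close> carries it over.\<close>

lemma V_relations:
  "V_psi * V_psi = 1" "V_psi * V_rho1 = V_rho1" "V_rho1 * V_rho1 = 1 + V_psi + V_rho1"
  "V_rho1 * V_rho2 = V_rho2 + V_rho3" "V_rho2 * V_rho2 = 1 + V_rho1 + V_rho2 + V_rho3"
proof -
  let ?s = "abs_rep_class sign_rep" and ?t = "abs_rep_class two_dim_rep" and ?u = "abs_rep_class standard_rep"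
  have table: "\<forall>g\<in>set class_reps. (class_char ?s g, class_char ?t g, class_char ?u g) \<in>
     {(1, 2, 3), (-1, 0, 1), (1, 2, -1), (1, -1, 0), (-1, 0, -1)}"
    using rep_char_table class_reps_permutes unfolding class_reps_def by (simp add: class_char_simps del: One_nat_def)
  have eqI: "x = y" if "\<And>g. g \<in> set class_reps \<Longrightarrow> class_char x g = class_char y g" for x y
    using that by (intro class_eqI map_cong refl)
  note simps = class_char_simps[OF class_reps_permutes]
  have "?s * ?s = 1" "?s * ?t = ?t" "?t * ?t = 1 + ?s + ?t" "?t * ?u = ?u + ?s * ?u" "?u * ?u = 1 + ?t + ?u + ?s * ?u"
    by (rule eqI, frule table[rule_format], auto simp: simps)+
  note this[THEN arg_cong[where f = class_in_ring], unfolded class_in_ring_simps, folded V_class]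
  then show "V_psi * V_psi = 1" "V_psi * V_rho1 = V_rho1" "V_rho1 * V_rho1 = 1 + V_psi + V_rho1"
    "V_rho1 * V_rho2 = V_rho2 + V_rho3" "V_rho2 * V_rho2 = 1 + V_rho1 + V_rho2 + V_rho3"
    by (simp_all add: V_rho3_def)
qed

lemma rep_ring_generated:
  obtains a b c d e :: int where
    "r = of_int a + of_int b * V_psi + of_int c * V_rho1 + of_int d * V_rho2 + of_int e * V_rho3"
proof -
  have "\<exists>p. r = abs_rep_ring p" by (induction r rule: rep_ring.abs_induct) blast
  then obtain x y where "r = abs_rep_ring (x, y)" by auto
  then have r: "r = class_in_ring x - class_in_ring y"
    by (simp add: class_in_ring_def minus_rep_ring_def uminus_rep_ring.abs_eq plus_rep_ring.abs_eq)
  obtain a b c d e where x: "x = irrep_combination a b c d e" by (rule irrep_combinationE)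
  obtain a' b' c' d' e' where y: "y = irrep_combination a' b' c' d' e'" by (rule irrep_combinationE)
  have *: "class_in_ring (irrep_combination a b c d e) =
    of_nat a + of_nat b * V_psi + of_nat c * V_rho1 + of_nat d * V_rho2 + of_nat e * V_rho3" for a b c d e
    by (simp add: irrep_combination_def class_in_ring_simps class_in_ring_of_nat V_class V_rho3_def)
  show thesis
    by (rule that[of "int a - int a'" "int b - int b'" "int c - int c'" "int d - int d'" "int e - int e'"])
      (simp add: r x y * algebra_simps)
qed

section \<open>Symmetric matrices of size 3 satisfying the relations\<close>

text \<open>The last case keeps a linear lower bound for the square, so that the quadratic equations
  below split into cases for linear arithmetic.\<close>

lemma int_nonneg_cases:
  "0 \<le> (x::int) \<Longrightarrow> x = 0 \<or> x = 1 \<or> x = 2 \<or> (3 \<le> x \<and> 3 * x \<le> x * x)"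
  using mult_right_mono[of 3 x x] by fastforce

text \<open>\<open>p\<close>, \<open>x\<close>, \<open>y\<close> are a row of a symmetric matrix,
  with \<open>p\<close> on the diagonal. The equation is the diagonal of the relation for
  \<open>V_rho1\<close> when \<open>V_psi\<close> acts trivially. \<open>square_sum_eq_3\<close> is
  the one for \<open>V_rho2\<close> when moreover \<open>V_rho1\<close> acts as 2, and
  \<open>square_sum_eq_1\<close> is that of \<open>V_psi * V_psi = 1\<close>.\<close>

lemma square_sum_eq_2:
  assumes "p * p + x * x + y * y = 2 + p" "0 \<le> p" "0 \<le> x" "0 \<le> (y::int)"
  shows "(p = 2 \<and> x = 0 \<and> y = 0) \<or> ((p = 0 \<or> p = 1) \<and> x = 1 \<and> y = 1)"
  using assms(1) int_nonneg_cases[OF assms(2)] int_nonneg_cases[OF assms(3)] int_nonneg_cases[OF assms(4)]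
  by (elim disjE conjE) auto

lemma square_sum_eq_3:
  assumes "p * p + x * x + y * y = 3 + 2 * p" "0 \<le> p" "0 \<le> x" "0 \<le> (y::int)"
  shows "x = 0 \<or> y = 0"
  using assms(1) int_nonneg_cases[OF assms(2)] int_nonneg_cases[OF assms(3)] int_nonneg_cases[OF assms(4)]
  by (elim disjE conjE) auto

lemma square_sum_eq_1:
  assumes "p * p + x * x + y * y = 1" "0 \<le> p" "0 \<le> x" "0 \<le> (y::int)"
  shows "(p = 1 \<and> x = 0 \<and> y = 0) \<or> (p = 0 \<and> x = 1 \<and> y = 0) \<or> (p = 0 \<and> x = 0 \<and> y = 1)"
  using assms(1) int_nonneg_cases[OF assms(2)] int_nonneg_cases[OF assms(3)] int_nonneg_cases[OF assms(4)]
  by (elim disjE conjE) auto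

lemma ex_3: "(\<exists>i::3. P i) \<longleftrightarrow> P 1 \<or> P 2 \<or> P 3"
  by (metis exhaust_3)

text \<open>\<open>A\<close>, \<open>P\<close>, \<open>R\<close>, \<open>Q\<close> are the matrices
  of \<open>V_psi\<close>, \<open>V_rho1\<close>, \<open>V_rho2\<close>, \<open>V_rho3\<close>.
  \<open>irr\<close> is irreducibility for one basis element: some class links it to
  another.\<close>

locale rank_3_matrices =
  fixes A P R Q :: "3 \<Rightarrow> 3 \<Rightarrow> int"
  assumes nonneg: "0 \<le> P i j" "0 \<le> R i j"
    and sym: "P i j = P j i" "R i j = R j i" "Q i j = Q j i"
    and AP: "(\<Sum>m\<in>UNIV. A i m * P m j) = P i j"
    and AR: "(\<Sum>m\<in>UNIV. A i m * R m j) = Q i j"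
    and PP: "(\<Sum>m\<in>UNIV. P i m * P m j) = of_bool (i = j) + A i j + P i j"
    and PR: "(\<Sum>m\<in>UNIV. P i m * R m j) = R i j + Q i j"
    and RR: "(\<Sum>m\<in>UNIV. R i m * R m j) = of_bool (i = j) + P i j + R i j + Q i j"
    and irr: "\<exists>j. j \<noteq> i \<and> (A i j \<noteq> 0 \<or> P i j \<noteq> 0 \<or> R i j \<noteq> 0 \<or> Q i j \<noteq> 0)"
begin

lemma sym3:
  "P 2 1 = P 1 2" "P 3 1 = P 1 3" "P 3 2 = P 2 3" "R 2 1 = R 1 2" "R 3 1 = R 1 3" "R 3 2 = R 2 3"
  using sym by auto

lemma trivial_case:
  assumes A: "\<And>i j. A i j = of_bool (i = j)"
  shows "((\<chi> i j. A i j), (\<chi> i j. P i j), (\<chi> i j. R i j)) = M31"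
proof -
  have Q: "Q i j = R i j" for i j
    using AR[of i j] exhaust_3[of i] by (auto simp: A sum_3)
  have P1: "P 1 1 * P 1 1 + P 1 2 * P 1 2 + P 1 3 * P 1 3 = 2 + P 1 1"
    and P2: "P 2 2 * P 2 2 + P 1 2 * P 1 2 + P 2 3 * P 2 3 = 2 + P 2 2"
    and P3: "P 3 3 * P 3 3 + P 1 3 * P 1 3 + P 2 3 * P 2 3 = 2 + P 3 3"
    and P12: "P 1 1 * P 1 2 + P 1 2 * P 2 2 + P 1 3 * P 2 3 = P 1 2"
    and P13: "P 1 1 * P 1 3 + P 1 2 * P 2 3 + P 1 3 * P 3 3 = P 1 3"
    using PP[of 1 1] PP[of 2 2] PP[of 3 3] PP[of 1 2] PP[of 1 3] by (simp_all add: A sum_3 sym3)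
  note P_cases = P1[THEN square_sum_eq_2] P2[THEN square_sum_eq_2] P3[THEN square_sum_eq_2]
  \<comment> \<open>Otherwise \<open>P\<close> is twice the identity. The diagonal of
    \<open>RR\<close> then leaves \<open>R\<close> at most one nonzero entry above the diagonal, and
    the third basis element is linked to no other.\<close>
  have "P 1 2 \<noteq> 0"
  proof
    assume "P 1 2 = 0"
    then have P0: "P 1 2 = 0" "P 1 3 = 0" "P 2 3 = 0" "P 1 1 = 2" "P 2 2 = 2" "P 3 3 = 2"
      using P_cases nonneg by auto
    have "R 1 2 = 0 \<or> R 1 3 = 0" "R 1 2 = 0 \<or> R 2 3 = 0" "R 1 3 = 0 \<or> R 2 3 = 0"
      using RR[of 1 1] RR[of 2 2] RR[of 3 3] nonneg
        square_sum_eq_3[of "R 1 1" "R 1 2" "R 1 3"] square_sum_eq_3[of "R 2 2" "R 1 2" "R 2 3"] square_sum_eq_3[of "R 3 3" "R 1 3" "R 2 3"]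
      by (simp_all add: A Q sum_3 sym3 P0)
    then show False
      using irr[of 1] irr[of 2] irr[of 3] by (auto simp: A Q sym3 P0 ex_3)
  qed
  then have P: "P 1 2 = 1" "P 1 3 = 1" "P 2 3 = 1" using P_cases nonneg by auto
  moreover have "P 1 1 = 0" "P 2 2 = 0" "P 3 3 = 0"
    using P12 P13 nonneg(1)[of 1 1] nonneg(1)[of 2 2] nonneg(1)[of 3 3] unfolding P by auto
  ultimately have P: "P 1 2 = 1" "P 1 3 = 1" "P 2 3 = 1" "P 1 1 = 0" "P 2 2 = 0" "P 3 3 = 0" by auto
  \<comment> \<open>\<open>P\<close> is now the all-ones matrix J minus the identity, so
    \<open>PR\<close> says that J times \<open>R\<close> is three times \<open>R\<close>. Columns of
    \<open>R\<close> are thus constant, and by symmetry \<open>R\<close> is.\<close>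
  define r where "r = R 1 2"
  have R: "R 1 1 = r" "R 1 2 = r" "R 1 3 = r" "R 2 2 = r" "R 2 3 = r" "R 3 3 = r"
    using PR[of 1 1] PR[of 1 2] PR[of 1 3] PR[of 2 1] PR[of 2 2] PR[of 2 3] PR[of 3 1] PR[of 3 2] PR[of 3 3]
    by (simp_all add: Q sum_3 sym3 P r_def)
  have "r * r + r * r + r * r = 1 + r + r" "0 \<le> r" using RR[of 1 2] nonneg(2)[of 1 2] by (simp_all add: Q sum_3 sym3 P R)
  then have "r = 1" using int_nonneg_cases[of r] by auto
  then show ?thesis
    by (simp add: M31_def Finite_Cartesian_Product.vec_eq_iff forall_3 vector_3 A P R sym3)
qed

lemma swap_case:
  assumes A: "A 1 1 = 0" "A 1 2 = 1" "A 1 3 = 0" "A 2 1 = 1" "A 2 2 = 0" "A 2 3 = 0" "A 3 1 = 0" "A 3 2 = 0" "A 3 3 = 1"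
  shows "((\<chi> i j. A i j), (\<chi> i j. P i j), (\<chi> i j. R i j)) \<in> {M32, M33}"
proof -
  have Q: "Q 1 j = R 2 j" "Q 2 j = R 1 j" "Q 3 j = R 3 j" for j
    using AR[of 1 j] AR[of 2 j] AR[of 3 j] by (simp_all add: A sum_3)
  define p q s where "p = P 1 1" "q = P 1 3" "s = P 3 3"
  have P: "P 1 1 = p" "P 1 2 = p" "P 1 3 = q" "P 2 2 = p" "P 2 3 = q" "P 3 3 = s"
    using AP[of 1 1] AP[of 1 2] AP[of 1 3] AP[of 2 1] AP[of 2 2] AP[of 2 3] 
    by (simp_all add: A sum_3 p_q_s_def sym3)
  define a b c d where "a = R 1 1" "b = R 1 2" "c = R 1 3" "d = R 3 3"
  \<comment> \<open>Symmetry of \<open>Q\<close> means that \<open>R\<close> commutes with the swap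
    of the two basis elements.\<close>
  have R: "R 1 1 = a" "R 1 2 = b" "R 1 3 = c" "R 2 2 = a" "R 2 3 = c" "R 3 3 = d"
    using sym(3)[of 1 2] sym(3)[of 1 3] by (simp_all add: Q sym3 a_b_c_d_def)
  have nn: "0 \<le> p" "0 \<le> q" "0 \<le> s" "0 \<le> a" "0 \<le> b" "0 \<le> c" "0 \<le> d"
    unfolding p_q_s_def a_b_c_d_def by (rule nonneg)+
  have P1: "p * p + p * p + q * q = 1 + p" and P2: "p * q + p * q + q * s = q" and P3: "q * q + q * q + s * s = 2 + s"
    using PP[of 1 1] PP[of 1 3] PP[of 3 3] by (simp_all add: A sum_3 sym3 P)
  have R1: "a * a + b * b + c * c = 1 + p + a + b" and R2: "a * c + b * c + c * d = q + c + c"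
    and R3: "c * c + c * c + d * d = 1 + s + d + d"
    using RR[of 1 1] RR[of 1 3] RR[of 3 3] by (simp_all add: A sum_3 sym3 P R Q)
  have pq: "p = 0 \<and> q = 1 \<or> p = 1 \<and> q = 0"
    using P1 int_nonneg_cases[OF nn(1)] int_nonneg_cases[OF nn(2)] by (elim disjE conjE) auto
  then show ?thesis
  proof
    assume pq: "p = 0 \<and> q = 1"
    then have s: "s = 1" using P2 by simp
    have cd: "c = a + b" "d = c + c" using PR[of 1 1] PR[of 1 3] by (simp_all add: sum_3 sym3 P R Q pq)
    have "a * a + b * b + (a * a + b * b + 2 * (a * b)) = 1 + a + b"
      using R1 pq by (simp add: cd algebra_simps)
    moreover have "0 \<le> a * b" using nn by simp
    \<comment> \<open>The two solutions are exchanged by interchanging \<open>R\<close> and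
      \<open>Q\<close>, that is \<open>V_rho2\<close> and \<open>V_rho3\<close>.\<close>
    ultimately have "a = 1 \<and> b = 0 \<or> a = 0 \<and> b = 1"
      using int_nonneg_cases[OF nn(4)] int_nonneg_cases[OF nn(5)] by (elim disjE conjE) auto
    then show ?thesis
    proof
      assume "a = 1 \<and> b = 0"
      then have "((\<chi> i j. A i j), (\<chi> i j. P i j), (\<chi> i j. R i j)) = M32"
        using cd by (simp add: M32_def Finite_Cartesian_Product.vec_eq_iff forall_3 vector_3 A P R sym3 pq s)
      then show ?thesis by simp
    next
      assume "a = 0 \<and> b = 1"
      then have "((\<chi> i j. A i j), (\<chi> i j. P i j), (\<chi> i j. R i j)) = M33"
        using cd by (simp add: M33_def Finite_Cartesian_Product.vec_eq_iff forall_3 vector_3 A P R sym3 pq s)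
      then show ?thesis by simp
    qed
  next
    assume pq: "p = 1 \<and> q = 0"
    then have "s = 2" using P3 int_nonneg_cases[OF nn(3)] by auto
    moreover have "c \<noteq> 0" using irr[of 3] pq by (auto simp: A Q P R sym3 ex_3)
    \<comment> \<open>Cancelling \<open>c\<close> in \<open>R2\<close> gives
      \<open>a + b + d = 2\<close>. For \<open>d\<close> equal to 0, 1, 2 the equation
      \<open>R3\<close> makes twice the square of \<open>c\<close> equal to 3, 4, 3, which is
      impossible.\<close>
    moreover have "c * (a + b + d - 2) = 0" using R2 pq by (simp add: algebra_simps)
    then have "d = 0 \<or> d = 1 \<or> d = 2" using nn \<open>c \<noteq> 0\<close> by auto
    ultimately have False using R3 int_nonneg_cases[OF nn(6)] by auto
    then show ?thesis ..
  qed
qed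

end

text \<open>By symmetry each row has sum of squares 1, hence a single entry 1. In the second case
  \<open>e\<close> numbers the fixed basis element last, as in \<open>M32\<close> and
  \<open>M33\<close>.\<close>

lemma involution_cases:
  fixes A :: "'m \<Rightarrow> 'm \<Rightarrow> int"
  assumes B: "card B = 3" and nonneg: "\<And>k l. k \<in> B \<Longrightarrow> l \<in> B \<Longrightarrow> 0 \<le> A k l"
    and sym: "\<And>k l. k \<in> B \<Longrightarrow> l \<in> B \<Longrightarrow> A k l = A l k"
    and AA: "\<And>k l. k \<in> B \<Longrightarrow> l \<in> B \<Longrightarrow> (\<Sum>m\<in>B. A k m * A m l) = of_bool (k = l)"
  obtains (trivial) e :: "3 \<Rightarrow> 'm" where "bij_betw e UNIV B" "\<And>i j. A (e i) (e j) = of_bool (i = j)"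
  | (swap) e :: "3 \<Rightarrow> 'm" where "bij_betw e UNIV B" "A (e 1) (e 1) = 0" "A (e 1) (e 2) = 1" "A (e 1) (e 3) = 0"
    "A (e 2) (e 1) = 1" "A (e 2) (e 2) = 0" "A (e 2) (e 3) = 0" "A (e 3) (e 1) = 0" "A (e 3) (e 2) = 0" "A (e 3) (e 3) = 1"
proof -
  obtain x y z where xyz: "B = {x, y, z}" "x \<noteq> y" "x \<noteq> z" "y \<noteq> z" using B by (metis card_3_iff)
  define E where "E x y z = (\<lambda>i::3. if i = 1 then x else if i = 2 then y else (z::'m))" for x y z
  have E [simp]: "E x y z 1 = x" "E x y z 2 = y" "E x y z 3 = z" for x y z by (simp_all add: E_def)
  have bij: "bij_betw (E x y z) UNIV {x, y, z}" if "x \<noteq> y" "x \<noteq> z" "y \<noteq> z" for x y z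
    using that unfolding bij_betw_def inj_on_def UNIV_3 by auto
  have eqs: "A x x * A x x + A x y * A x y + A x z * A x z = 1" "A y y * A y y + A x y * A x y + A y z * A y z = 1"
    "A z z * A z z + A x z * A x z + A y z * A y z = 1"
    and s: "A y x = A x y" "A z x = A x z" "A z y = A y z"
    using AA[of x x] AA[of y y] AA[of z z] sym[of x y] sym[of x z] sym[of y z] xyz by (simp_all add: xyz ac_simps)
  have "\<And>k l. k \<in> {x,y,z} \<Longrightarrow> l \<in> {x,y,z} \<Longrightarrow> 0 \<le> A k l" using nonneg xyz by auto
  then have nn: "0 \<le> A x x" "0 \<le> A y y" "0 \<le> A z z" "0 \<le> A x y" "0 \<le> A x z" "0 \<le> A y z" by auto
  consider "A x x = 1" "A y y = 1" "A z z = 1" "A x y = 0" "A x z = 0" "A y z = 0"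
    | "A x x = 0" "A y y = 0" "A z z = 1" "A x y = 1" "A x z = 0" "A y z = 0"
    | "A x x = 0" "A y y = 1" "A z z = 0" "A x y = 0" "A x z = 1" "A y z = 0"
    | "A x x = 1" "A y y = 0" "A z z = 0" "A x y = 0" "A x z = 0" "A y z = 1"
    using square_sum_eq_1[OF eqs(1) nn(1,4,5)] square_sum_eq_1[OF eqs(2) nn(2,4,6)] square_sum_eq_1[OF eqs(3) nn(3,5,6)]
    by (elim disjE conjE) simp_all
  then show thesis
  proof cases
    case 1
    have "A (E x y z i) (E x y z j) = of_bool (i = j)" for i j
      using exhaust_3[of i] exhaust_3[of j] 1 s by auto
    then show thesis using trivial[of "E x y z"] bij xyz by auto
  next
    case 2
    then show thesis using swap[of "E x y z"] bij[of x y z] xyz s by auto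
  next
    case 3
    then show thesis using swap[of "E x z y"] bij[of x z y] xyz s by (auto simp: insert_commute)
  next
    case 4
    then show thesis using swap[of "E y z x"] bij[of y z x] xyz s by (auto simp: insert_commute)
  qed
qed

section \<open>Modules over the representation ring\<close>

lemma module_int_smul:
  assumes "Modules.module smul"
  shows "Modules.module (int_smul smul)"
proof -
  interpret Modules.module smul by fact
  show ?thesis by unfold_locales (simp_all add: scale_right_distrib scale_left_distrib)
qed

lemma module_hom_int_smul:
  assumes "Modules.module_hom smul smul' F"
  shows "Modules.module_hom (int_smul smul) (int_smul smul') F"
proof -
  interpret Modules.module_hom smul smul' F by fact
  show ?thesis
    using module_int_smul[OF m1.module_axioms] module_int_smul[OF m2.module_axioms]
    by (auto simp: module_hom_iff add scale)
qed

lemma structure_constant_transport: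
  assumes hom: "Modules.module_hom smul smul' F" and F: "bij F" and B: "finite B" "Z_basis smul B"
  shows "Z_basis smul' (F ` B)"
    and "l \<in> B \<Longrightarrow> k \<in> B \<Longrightarrow> structure_constant smul' (F ` B) r (F l) (F k) = structure_constant smul B r l k"
proof -
  interpret H: Modules.module_hom smul smul' F by fact
  interpret Z: Modules.module_hom "int_smul smul" "int_smul smul'" F by (rule module_hom_int_smul[OF hom])
  have ind: "\<not> Z.m1.dependent B" and span: "Z.m1.span B = UNIV" using B(2) by (simp_all add: Z_basis_def)
  have inj: "inj F" and surj: "surj F" using F by (auto simp: bij_def)
  have ind': "\<not> Z.m2.dependent (F ` B)"
    using Z.independent_injective_image[OF ind] inj by (simp add: span)
  have span': "Z.m2.span (F ` B) = UNIV"
    using Z.span_image[of B] surj by (simp add: span)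
  show "Z_basis smul' (F ` B)" using ind' span' by (simp add: Z_basis_def)
  assume lk: "l \<in> B" "k \<in> B"
  \<comment> \<open>The coordinates of \<open>smul r l\<close> moved along \<open>F\<close>, and 0
    off the basis, where \<open>representation\<close> vanishes. Uniqueness of coordinates
    identifies \<open>f\<close>.\<close>
  define f where "f b = (if b \<in> F ` B then Z.m1.representation B (smul r l) (inv' F b) else 0)" for b
  have "Z.m2.representation (F ` B) (F (smul r l)) = f"
  proof (rule Z.m2.representation_eqI[OF ind'])
    show "finite {b. f b \<noteq> 0}" by (rule finite_subset[of _ "F ` B"]) (auto simp: f_def B)
    have "(\<Sum>b | f b \<noteq> 0. smul' (of_int (f b)) b) = (\<Sum>b\<in>F ` B. smul' (of_int (f b)) b)"
      by (rule sum.mono_neutral_left) (auto simp: f_def B)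
    also have "\<dots> = (\<Sum>b\<in>B. smul' (of_int (f (F b))) (F b))"
      using inj by (subst sum.reindex) (auto intro: inj_on_subset)
    also have "\<dots> = F (\<Sum>b\<in>B. smul (of_int (Z.m1.representation B (smul r l) b)) b)"
      using inj by (simp add: f_def H.sum H.scale)
    also have "\<dots> = F (smul r l)"
      using Z.m1.sum_representation_eq[OF ind, of "smul r l" B] B(1) by (simp add: span)
    finally show "(\<Sum>b | f b \<noteq> 0. smul' (of_int (f b)) b) = F (smul r l)" .
  qed (auto simp: span' f_def split: if_split_asm)
  then show "structure_constant smul' (F ` B) r (F l) (F k) = structure_constant smul B r l k"
    using lk inj by (simp add: structure_constant_def f_def flip: H.scale)
qed

lemma based_module_transport:
  assumes "Modules.module_hom smul smul' F" "bij F" "finite B" "based_module smul B"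
  shows "based_module smul' (F ` B)"
proof -
  have B: "Z_basis smul B" using assms(4) by (simp add: based_module_def Zplus_module_def)
  interpret Modules.module_hom smul smul' F by fact
  show ?thesis
    using structure_constant_transport[OF assms(1-3) B] assms(4) m2.module_axioms
    by (simp add: based_module_def Zplus_module_def)
qed

section \<open>Coordinates and structure constants\<close>

locale finite_Zplus_module =
  fixes smul :: "rep_ring \<Rightarrow> 'm::ab_group_add \<Rightarrow> 'm" and B :: "'m set"
  assumes Zplus: "Zplus_module smul B" and fin: "finite B"
begin

sublocale M: Modules.module smul using Zplus by (simp add: Zplus_module_def)

sublocale Z: Modules.module "int_smul smul" by (rule module_int_smul[OF M.module_axioms])

lemma independent: "\<not> Z.dependent B" and span: "Z.span B = UNIV"
  using Zplus by (simp_all add: Zplus_module_def Z_basis_def)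

abbreviation coord :: "'m \<Rightarrow> 'm \<Rightarrow> int" where "coord \<equiv> Z.representation B"

abbreviation K :: "rep_ring \<Rightarrow> 'm \<Rightarrow> 'm \<Rightarrow> int" where "K \<equiv> structure_constant smul B"

lemma coord_add: "coord (x + y) k = coord x k + coord y k"
  by (simp add: Z.representation_add independent span)

lemma coord_scale: "coord (smul (of_int n) x) k = n * coord x k"
  by (simp add: Z.representation_scale independent span)

lemma coord_basis: "l \<in> B \<Longrightarrow> coord l k = of_bool (l = k)"
  by (simp add: Z.representation_basis independent eq_commute)

lemma coord_sum: "coord (\<Sum>i\<in>I. f i) k = (\<Sum>i\<in>I. coord (f i) k)"
  by (simp add: Z.representation_sum independent span)

lemma sum_coord: "(\<Sum>b\<in>B. smul (of_int (coord x b)) b) = x"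
  using Z.sum_representation_eq[OF independent, of x B] fin by (simp add: span)

lemma coord_smul: "coord (smul r x) k = (\<Sum>m\<in>B. coord x m * K r m k)"
proof -
  have "smul r x = smul r (\<Sum>m\<in>B. smul (of_int (coord x m)) m)" by (simp only: sum_coord)
  also have "\<dots> = (\<Sum>m\<in>B. smul (of_int (coord x m)) (smul r m))"
    unfolding M.scale_sum_right by (intro sum.cong refl M.scale_left_commute)
  finally show ?thesis by (simp only: coord_sum coord_scale structure_constant_def)
qed

lemma K_one: "l \<in> B \<Longrightarrow> K 1 l k = of_bool (l = k)"
  by (simp add: structure_constant_def coord_basis)

lemma K_add: "K (r + s) l k = K r l k + K s l k"
  by (simp add: structure_constant_def M.scale_left_distrib coord_add)

text \<open>\<open>K r l k\<close> is the entry in row \<open>k\<close> and column \<open>l\<close>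
  of the matrix of \<open>r\<close>, so this is matrix multiplication with the factors written in
  reverse order.\<close>

lemma K_mult: "K (r * s) l k = (\<Sum>m\<in>B. K s l m * K r m k)"
  using coord_smul[of r "smul s l" k] by (simp only: structure_constant_def M.scale_scale)

lemma invariant_subset_trivial:
  assumes irr: "irreducible_Zplus_module smul B" and S: "S \<subseteq> B" "S \<noteq> {}"
    and inv: "\<And>r l k. r \<in> irreducible_classes \<Longrightarrow> l \<in> S \<Longrightarrow> k \<in> B - S \<Longrightarrow> K r l k = 0"
  shows "S = B"
proof (rule ccontr)
  assume "S \<noteq> B"
  have irr_cl: "smul r l \<in> Z.span S" if "r \<in> irreducible_classes" "l \<in> S" for r l
  proof -
    have "smul r l = (\<Sum>b\<in>B. smul (of_int (K r l b)) b)"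
      using sum_coord[of "smul r l"] by (simp add: structure_constant_def)
    also have "\<dots> = (\<Sum>b\<in>S. smul (of_int (K r l b)) b)"
      using fin S inv[OF that] by (intro sum.mono_neutral_right) auto
    also have "\<dots> \<in> Z.span S" by (intro Z.span_sum Z.span_scale Z.span_base)
    finally show ?thesis .
  qed
  have gen: "smul r l \<in> Z.span S" if l: "l \<in> S" for r l
  proof -
    obtain a b c d e where r: "r = of_int a + of_int b * V_psi + of_int c * V_rho1 + of_int d * V_rho2 + of_int e * V_rho3"
      by (rule rep_ring_generated)
    show ?thesis
      unfolding r M.scale_left_distrib M.scale_scale[symmetric]
      using irr_cl[OF _ l] Z.span_base[OF l] by (intro Z.span_add Z.span_scale) (auto simp: irreducible_classes_def)
  qed
  have "M.subspace (Z.span S)"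
  proof (rule M.subspaceI)
    fix r x assume "x \<in> Z.span S"
    then show "smul r x \<in> Z.span S"
    proof (induction rule: Z.span_induct_alt)
      case base
      show ?case by (simp add: Z.span_zero)
    next
      case (step n l x)
      have "smul r (smul (of_int n) l + x) = smul (of_int n) (smul r l) + smul r x"
        by (simp add: M.scale_right_distrib mult.commute)
      then show ?case using step gen by (simp add: Z.span_add Z.span_scale)
    qed
  qed (auto intro: Z.span_zero Z.span_add)
  then show False using irr S \<open>S \<noteq> B\<close> unfolding irreducible_Zplus_module_def by blast
qed

text \<open>\<open>smul'\<close> is \<open>smul\<close> conjugated by the coordinate isomorphism
  \<open>F\<close> with inverse \<open>G\<close>. Thus \<open>F\<close> is an equivalence by
  construction, and every ring element acts on column vectors by its matrix of structure
  constants.\<close>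

lemma equivalent_matrices:
  fixes e :: "3 \<Rightarrow> 'm"
  assumes e: "bij_betw e UNIV B" and based: "based_module smul B"
  obtains smul' :: "rep_ring \<Rightarrow> int^3 \<Rightarrow> int^3" where "based_module smul' cart_basis" "Zplus_equivalent smul B smul' cart_basis"
    "\<And>r. smul' r = (*v) (\<chi> i j. K r (e j) (e i))"
proof -
  define F :: "'m \<Rightarrow> int^3" where "F x = (\<chi> i. coord x (e i))" for x
  define G :: "int^3 \<Rightarrow> 'm" where "G y = (\<Sum>i\<in>UNIV. smul (of_int (vec_nth y i)) (e i))" for y
  define smul' :: "rep_ring \<Rightarrow> int^3 \<Rightarrow> int^3" where "smul' r y = F (smul r (G y))" for r y
  have e_in: "e i \<in> B" for i using e by (auto simp: bij_betw_def)
  have e_inj: "e i = e j \<longleftrightarrow> i = j" for i j using e by (auto simp: bij_betw_def inj_on_def)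
  have GF: "G (F x) = x" for x
    using sum_coord[of x] sum.reindex_bij_betw[OF e, of "\<lambda>b. smul (of_int (coord x b)) b"] by (simp add: F_def G_def)
  have FG: "F (G y) = y" for y
  proof -
    have "coord (G y) (e i) = (\<Sum>j\<in>UNIV. if j = i then vec_nth y j else 0)" for i
      unfolding G_def coord_sum by (intro sum.cong) (auto simp: coord_scale coord_basis e_in e_inj)
    then show ?thesis by (simp add: F_def Finite_Cartesian_Product.vec_eq_iff)
  qed
  have F_add: "F (x + y) = F x + F y" for x y by (simp add: F_def Finite_Cartesian_Product.vec_eq_iff coord_add)
  have G_add: "G (x + y) = G x + G y" for x y
  proof -
    have "G (x + y) = G (F (G x + G y))" by (simp add: F_add FG)
    then show ?thesis by (simp add: GF)
  qed
  have hom: "Modules.module_hom smul smul' F"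
    unfolding module_hom_iff
  proof (intro conjI allI M.module_axioms)
    show "Modules.module smul'"
      by unfold_locales (simp_all add: smul'_def G_add GF FG F_add[symmetric] M.scale_right_distrib M.scale_left_distrib)
  qed (simp_all add: F_add smul'_def GF)
  have bij: "bij F" by (rule bij_betw_byWitness[where f' = G]) (auto simp: FG GF)
  have Fe: "F (e i) = axis i 1" for i
    by (simp add: F_def Finite_Cartesian_Product.vec_eq_iff coord_basis e_in e_inj axis_def)
  have "F ` B = (\<lambda>i. F (e i)) ` UNIV" using e by (auto simp: bij_betw_def)
  then have FB: "F ` B = cart_basis" by (auto simp: Fe cart_basis_def)
  show thesis
  proof
    show "based_module smul' cart_basis" using based_module_transport[OF hom bij fin based] by (simp add: FB)
    have "bij_betw F B cart_basis" by (rule bij_betw_subset[OF bij]) (simp_all add: FB)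
    then show "Zplus_equivalent smul B smul' cart_basis" unfolding Zplus_equivalent_def using hom bij by blast
    show "smul' r = (*v) (\<chi> i j. K r (e j) (e i))" for r
    proof
      fix y
      have "coord (smul r (G y)) (e i) = (\<Sum>j\<in>UNIV. K r (e j) (e i) * vec_nth y j)" for i
      proof -
        have "coord (G y) (e j) = vec_nth y j" for j
          using FG[of y] by (simp add: F_def Finite_Cartesian_Product.vec_eq_iff)
        moreover have "coord (smul r (G y)) (e i) = (\<Sum>j\<in>UNIV. coord (G y) (e j) * K r (e j) (e i))"
          unfolding coord_smul by (rule sum.reindex_bij_betw[OF e, symmetric])
        ultimately show ?thesis by (simp add: mult.commute)
      qed
      then show "smul' r y = (\<chi> i j. K r (e j) (e i)) *v y"
        by (simp add: smul'_def F_def matrix_vector_mult_def)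
    qed
  qed
qed

end

section \<open>Classification in rank 3\<close>

theorem proposition3p3:
  fixes smul :: "rep_ring \<Rightarrow> 'm::ab_group_add \<Rightarrow> 'm" and B :: "'m set"
  assumes "based_module smul B"
    and "irreducible_Zplus_module smul B"
    and "card B = 3"
  shows "\<exists>D\<in>{M31, M32, M33}. \<exists>smul'.
    based_module_given_by smul' D \<and> Zplus_equivalent smul B smul' cart_basis"
proof -
  have fin: "finite B" using assms(3) by (metis card.infinite zero_neq_numeral)
  interpret finite_Zplus_module smul B
    using assms(1) fin by unfold_locales (simp add: based_module_def)
  have cl: "V_psi \<in> irreducible_classes" "V_rho1 \<in> irreducible_classes" "V_rho2 \<in> irreducible_classes" "V_rho3 \<in> irreducible_classes"
    by (simp_all add: irreducible_classes_def)
  have nonneg: "0 \<le> K r l k" if "r \<in> irreducible_classes" "l \<in> B" "k \<in> B" for r l k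
    using Zplus that by (simp add: Zplus_module_def)
  have sym: "K r l k = K r k l" if "r \<in> irreducible_classes" "l \<in> B" "k \<in> B" for r l k
    using assms(1) that by (simp add: based_module_def)
  have matrices: "rank_3_matrices (\<lambda>i j. K V_psi (e j) (e i)) (\<lambda>i j. K V_rho1 (e j) (e i)) (\<lambda>i j. K V_rho2 (e j) (e i)) (\<lambda>i j. K V_rho3 (e j) (e i))"
    if e: "bij_betw e UNIV B" for e :: "3 \<Rightarrow> 'm"
  proof -
    have e_in: "e i \<in> B" for i using e by (auto simp: bij_betw_def)
    have e_inj: "e i = e j \<longleftrightarrow> i = j" for i j using e by (auto simp: bij_betw_def inj_on_def)
    have mult: "(\<Sum>m\<in>UNIV. K r (e m) (e i) * K s (e j) (e m)) = K (r * s) (e j) (e i)" for r s i j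
      unfolding K_mult using sum.reindex_bij_betw[OF e, of "\<lambda>m. K s (e j) m * K r m (e i)"] by (simp add: mult.commute)
    show ?thesis
    proof
      fix i j :: 3
      show "\<exists>j. j \<noteq> i \<and> (K V_psi (e j) (e i) \<noteq> 0 \<or> K V_rho1 (e j) (e i) \<noteq> 0 \<or> K V_rho2 (e j) (e i) \<noteq> 0 \<or> K V_rho3 (e j) (e i) \<noteq> 0)"
      proof (rule ccontr)
        assume *: "\<not> ?thesis"
        have "{e i} = B"
        proof (rule invariant_subset_trivial[OF assms(2)])
          fix r l k assume r: "r \<in> irreducible_classes" and lk: "l \<in> {e i}" "k \<in> B - {e i}"
          then obtain j where j: "k = e j" "j \<noteq> i" using e by (auto simp: bij_betw_def)
          \<comment> \<open>The negated claim says that no other basis element is sent onto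
            \<open>e i\<close>; symmetry converts this into \<open>e i\<close> being sent to no
            other, which is invariance of the singleton.\<close>
          then have "K r k l = 0" using r lk * by (auto simp: irreducible_classes_def K_one e_in e_inj)
          then show "K r l k = 0" using sym r lk e_in by auto
        qed (use e_in in auto)
        then have "card B = card {e i}" by simp
        then show False using assms(3) by simp
      qed
    qed (auto simp: nonneg cl e_in mult V_relations K_add K_one e_inj intro: sym simp flip: V_rho3_def)
  qed
  have "\<exists>e. bij_betw e UNIV B \<and> ((\<chi> i j. K V_psi (e j) (e i)), (\<chi> i j. K V_rho1 (e j) (e i)), (\<chi> i j. K V_rho2 (e j) (e i))) \<in> {M31, M32, M33}"
  \<comment> \<open>\<open>K\<close> takes the column before the row, hence the exchanged
    arguments.\<close>
  proof (rule involution_cases[of B "\<lambda>k l. K V_psi l k"])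
    fix k l assume "k \<in> B" "l \<in> B"
    then show "(\<Sum>m\<in>B. K V_psi m k * K V_psi l m) = of_bool (k = l)"
      using K_mult[of V_psi V_psi l k] by (auto simp: V_relations K_one mult.commute)
  next
    fix e :: "3 \<Rightarrow> 'm" assume e: "bij_betw e UNIV B" and "\<And>i j. K V_psi (e j) (e i) = of_bool (i = j)"
    then show ?thesis using rank_3_matrices.trivial_case[OF matrices[OF e]] by blast
  next
    fix e :: "3 \<Rightarrow> 'm" assume e: "bij_betw e UNIV B" and *: "K V_psi (e 1) (e 1) = 0" "K V_psi (e 2) (e 1) = 1" "K V_psi (e 3) (e 1) = 0"
      "K V_psi (e 1) (e 2) = 1" "K V_psi (e 2) (e 2) = 0" "K V_psi (e 3) (e 2) = 0" "K V_psi (e 1) (e 3) = 0" "K V_psi (e 2) (e 3) = 0" "K V_psi (e 3) (e 3) = 1"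
    then show ?thesis using rank_3_matrices.swap_case[OF matrices[OF e] *] by blast
  qed (use assms(3) nonneg sym cl in auto)
  then obtain e where e: "bij_betw e UNIV B"
    and D: "((\<chi> i j. K V_psi (e j) (e i)), (\<chi> i j. K V_rho1 (e j) (e i)), (\<chi> i j. K V_rho2 (e j) (e i))) \<in> {M31, M32, M33}"
    by blast
  obtain smul' :: "rep_ring \<Rightarrow> int^3 \<Rightarrow> int^3" where smul': "based_module smul' cart_basis" "Zplus_equivalent smul B smul' cart_basis"
    "\<And>r. smul' r = (*v) (\<chi> i j. K r (e j) (e i))"
    using equivalent_matrices[OF e assms(1)] by blast
  interpret M': Modules.module smul' using smul'(1) by (simp add: based_module_def Zplus_module_def)
  have rho3: "smul' V_rho3 = (*v) ((\<chi> i j. K V_psi (e j) (e i)) ** (\<chi> i j. K V_rho2 (e j) (e i)))"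
  proof
    fix y
    have "smul' V_rho3 y = smul' V_psi (smul' V_rho2 y)" by (simp add: V_rho3_def)
    also have "\<dots> = ((\<chi> i j. K V_psi (e j) (e i)) ** (\<chi> i j. K V_rho2 (e j) (e i))) *v y"
      unfolding smul'(3) by (rule matrix_vector_mul_assoc)
    finally show "smul' V_rho3 y = ((\<chi> i j. K V_psi (e j) (e i)) ** (\<chi> i j. K V_rho2 (e j) (e i))) *v y" .
  qed
  have "based_module_given_by smul'
      ((\<chi> i j. K V_psi (e j) (e i)), (\<chi> i j. K V_rho1 (e j) (e i)), (\<chi> i j. K V_rho2 (e j) (e i)))"
    unfolding based_module_given_by_def prod.case by (intro conjI smul'(1,3) rho3)
  then show ?thesis using D smul'(2) by blast
qed

end
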